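(* Let $(G,C_5)$ be a pair, where $C_5$ is a Hamiltonian cycle of $G$ on $5$ vertices, that admits a representation and does not satisfy $(P2)$. Then (i) with the vertices labelled $0,1,2,3,4$ in the cyclic order of $C_5$ (for a suitable labelling), $E(G)=E(C_5)\cup\{\{0,2\},\{0,3\},\{1,3\},\{1,4\}\}$ (i.e., $G$ is $K_5$ minus the edge $\{2,4\}$); and (ii) $(G,C_5)$ has a unique minimal representation, namely: $T$ has vertices $a,b,u,m,v,c,d$ and edges $au,bu,um,mv,vc,vd$, and $P_0=a\!-\!u\!-\!m\!-\!v$, $P_1=u\!-\!m\!-\!v\!-\!c$, $P_2=b\!-\!u\!-\!m$, $P_3=b\!-\!u\!-\!m\!-\!v\!-\!d$, $P_4=m\!-\!v\!-\!d$.
   Context: A representation $\langle T,\mathcal P\rangle$: a tree $T$ and a family $\mathcal P=(P_v)$ of simple paths of $T$ with at least one edge. Paths intersect if they share an edge; $\mathrm{split}(P,P')$ is the set of vertices of degree $\ge3$ in $P\cup P'$; $P\sim P'$ means they intersect and $\mathrm{split}(P,P')=\emptyset$. It represents the pair $(G,G')$ ($V(G)=V(G')$, $E(G')\subseteq E(G)$) if $uv\in E(G)$ iff $P_u,P_v$ intersect, and $uv\in E(G')$ iff $P_u\sim P_v$. Minifying operations: contracting an edge of $T$ (and of all paths using it); removing an end edge from a path. A representation is minimal if no different representation (up to isomorphism) obtainable from it by minifying operations represents the same pair. $(G,C)$ satisfies $(P2)$ if no four vertices induce $K_4$ in $G$ and a path $P_4$ in $C$. *)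

theory Defs
  imports Main
begin

record 'a graph =
  verts :: "'a set"
  edges :: "'a set set"

definition simple_graph :: "'a graph \<Rightarrow> bool" where
  "simple_graph G \<longleftrightarrow> finite (verts G) \<and> (\<forall>e\<in>edges G. e \<subseteq> verts G \<and> card e = 2)"

definition subgraph :: "'a graph \<Rightarrow> 'a graph \<Rightarrow> bool" where
  "subgraph H G \<longleftrightarrow> verts H \<subseteq> verts G \<and> edges H \<subseteq> edges G"

definition induced_subgraph :: "'a graph \<Rightarrow> 'a set \<Rightarrow> 'a graph" where
  "induced_subgraph G S = \<lparr>verts = S, edges = {e \<in> edges G. e \<subseteq> S}\<rparr>"

fun path_edges :: "'a list \<Rightarrow> 'a set set" where
  "path_edges (x # y # xs) = insert {x, y} (path_edges (y # xs))"
| "path_edges _ = {}"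

definition simple_path :: "'a graph \<Rightarrow> 'a list \<Rightarrow> bool" where
  "simple_path G xs \<longleftrightarrow>
     xs \<noteq> [] \<and> distinct xs \<and> set xs \<subseteq> verts G \<and> path_edges xs \<subseteq> edges G"

definition complete_graph :: "'a graph \<Rightarrow> bool" where
  "complete_graph G \<longleftrightarrow> edges G = {{x, y} | x y. x \<in> verts G \<and> y \<in> verts G \<and> x \<noteq> y}"

definition path_graph :: "'a graph \<Rightarrow> bool" where
  "path_graph G \<longleftrightarrow>
     (\<exists>xs. xs \<noteq> [] \<and> distinct xs \<and> verts G = set xs \<and> edges G = path_edges xs)"

definition cycle_edges :: "'a list \<Rightarrow> 'a set set" where
  "cycle_edges xs = path_edges (xs @ [hd xs])"

definition cycle_graph :: "'a graph \<Rightarrow> bool" where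
  "cycle_graph G \<longleftrightarrow>
     (\<exists>xs. length xs \<ge> 3 \<and> distinct xs \<and> verts G = set xs \<and> edges G = cycle_edges xs)"

definition hamiltonian_cycle :: "'a graph \<Rightarrow> 'a graph \<Rightarrow> bool" where
  "hamiltonian_cycle C G \<longleftrightarrow> cycle_graph C \<and> subgraph C G \<and> verts C = verts G"

definition connected_graph :: "'a graph \<Rightarrow> bool" where
  "connected_graph G \<longleftrightarrow> verts G \<noteq> {} \<and>
     (\<forall>x\<in>verts G. \<forall>y\<in>verts G. \<exists>xs. simple_path G xs \<and> hd xs = x \<and> last xs = y)"

definition tree :: "'a graph \<Rightarrow> bool" where
  "tree T \<longleftrightarrow> simple_graph T \<and> connected_graph T \<and> \<not> (\<exists>C. cycle_graph C \<and> subgraph C T)"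

text \<open>
  A path with at least one edge is represented by its set of edges, which determines it as a
  subgraph of the tree. The family of paths is indexed by the vertices of the represented graphs;
  only its values on this vertex set (the parameter \<open>V\<close> below) are meaningful.
\<close>

record ('v, 't) representation =
  host :: "'t graph"
  rpath :: "'v \<Rightarrow> 't set set"

definition is_representation :: "'v set \<Rightarrow> ('v, 't) representation \<Rightarrow> bool" where
  "is_representation V R \<longleftrightarrow> tree (host R) \<and>
     (\<forall>v\<in>V. \<exists>xs. simple_path (host R) xs \<and> length xs \<ge> 2 \<and> rpath R v = path_edges xs)"

definition intersecting :: "'t set set \<Rightarrow> 't set set \<Rightarrow> bool" where
  "intersecting P Q \<longleftrightarrow> P \<inter> Q \<noteq> {}"

definition split_vertices :: "'t set set \<Rightarrow> 't set set \<Rightarrow> 't set" where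
  "split_vertices P Q = {x. card {e \<in> P \<union> Q. x \<in> e} \<ge> 3}"

definition nonsplitting :: "'t set set \<Rightarrow> 't set set \<Rightarrow> bool" where
  "nonsplitting P Q \<longleftrightarrow> intersecting P Q \<and> split_vertices P Q = {}"

definition graph_pair :: "'v graph \<Rightarrow> 'v graph \<Rightarrow> bool" where
  "graph_pair G G' \<longleftrightarrow>
     simple_graph G \<and> simple_graph G' \<and> verts G = verts G' \<and> edges G' \<subseteq> edges G"

definition represents :: "('v, 't) representation \<Rightarrow> 'v graph \<Rightarrow> 'v graph \<Rightarrow> bool" where
  "represents R G G' \<longleftrightarrow> is_representation (verts G) R \<and>
     (\<forall>u\<in>verts G. \<forall>v\<in>verts G. u \<noteq> v \<longrightarrow>
        ({u, v} \<in> edges G \<longleftrightarrow> intersecting (rpath R u) (rpath R v)) \<and>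
        ({u, v} \<in> edges G' \<longleftrightarrow> nonsplitting (rpath R u) (rpath R v)))"

definition rep_isomorphic ::
    "'v set \<Rightarrow> ('v, 's) representation \<Rightarrow> ('v, 't) representation \<Rightarrow> bool" where
  "rep_isomorphic V R R' \<longleftrightarrow>
     (\<exists>f. bij_betw f (verts (host R)) (verts (host R')) \<and>
          edges (host R') = (`) f ` edges (host R) \<and>
          (\<forall>v\<in>V. rpath R' v = (`) f ` rpath R v))"

definition contract_map :: "'t \<Rightarrow> 't \<Rightarrow> 't \<Rightarrow> 't" where
  "contract_map x y z = (if z = y then x else z)"

definition contract_edges :: "'t \<Rightarrow> 't \<Rightarrow> 't set set \<Rightarrow> 't set set" where
  "contract_edges x y E = (`) (contract_map x y) ` (E - {{x, y}})"

definition contract_rep :: "'t \<Rightarrow> 't \<Rightarrow> ('v, 't) representation \<Rightarrow> ('v, 't) representation" where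
  "contract_rep x y R =
     \<lparr>host = \<lparr>verts = contract_map x y ` verts (host R),
              edges = contract_edges x y (edges (host R))\<rparr>,
      rpath = (\<lambda>v. contract_edges x y (rpath R v))\<rparr>"

text \<open>
  Both ends of a path are covered by the second rule, since \<open>x # y # xs\<close> may traverse the path in
  either direction. An operation may leave a path without edges; such a path never regains an edge,
  and the result is then excluded by the predicate \<open>represents\<close> in the definition of minimality.
\<close>

inductive minify :: "'v set \<Rightarrow> ('v, 't) representation \<Rightarrow> ('v, 't) representation \<Rightarrow> bool"
  for V where
  contract: "{x, y} \<in> edges (host R) \<Longrightarrow> x \<noteq> y \<Longrightarrow> minify V R (contract_rep x y R)"
| remove_end: "v \<in> V \<Longrightarrow> simple_path (host R) (x # y # xs) \<Longrightarrow>
    rpath R v = path_edges (x # y # xs) \<Longrightarrow>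
    minify V R (R\<lparr>rpath := (rpath R)(v := rpath R v - {{x, y}})\<rparr>)"

definition minimal_representation ::
    "('v, 't) representation \<Rightarrow> 'v graph \<Rightarrow> 'v graph \<Rightarrow> bool" where
  "minimal_representation R G G' \<longleftrightarrow> represents R G G' \<and>
     \<not> (\<exists>R'. (minify (verts G))\<^sup>*\<^sup>* R R' \<and> represents R' G G' \<and> \<not> rep_isomorphic (verts G) R R')"

definition P2 :: "'v graph \<Rightarrow> 'v graph \<Rightarrow> bool" where
  "P2 G C \<longleftrightarrow> \<not> (\<exists>S \<subseteq> verts G. card S = 4 \<and>
     complete_graph (induced_subgraph G S) \<and> path_graph (induced_subgraph C S))"

datatype node = Na | Nb | Nu | Nm | Nv | Nc | Nd

definition canonical_tree :: "node graph" where
  "canonical_tree =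
     \<lparr>verts = {Na, Nb, Nu, Nm, Nv, Nc, Nd},
      edges = {{Na, Nu}, {Nb, Nu}, {Nu, Nm}, {Nm, Nv}, {Nv, Nc}, {Nv, Nd}}\<rparr>"

definition canonical_rep :: "'v \<Rightarrow> 'v \<Rightarrow> 'v \<Rightarrow> 'v \<Rightarrow> 'v \<Rightarrow> ('v, node) representation" where
  "canonical_rep v0 v1 v2 v3 v4 =
     \<lparr>host = canonical_tree,
      rpath = (\<lambda>_. {})
       (v0 := path_edges [Na, Nu, Nm, Nv],
        v1 := path_edges [Nu, Nm, Nv, Nc],
        v2 := path_edges [Nb, Nu, Nm],
        v3 := path_edges [Nb, Nu, Nm, Nv, Nd],
        v4 := path_edges [Nm, Nv, Nd])\<rparr>"

end

theory Submission
  imports Defs "HOL-Library.Sublist"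
begin

text \<open>
  Four paths \<open>P\<^sub>0, \<dots>, P\<^sub>3\<close> of a tree that represent \<open>(K\<^sub>4, P\<^sub>4)\<close> have a common edge \<open>e\<close>, by a Helly
  argument. Seen from \<open>e\<close> every path is a pair of words (its two arms), and two paths through \<open>e\<close>
  are non-splitting iff their arms are prefix-comparable on both sides. Hence \<open>P\<^sub>0\<close> diverges from
  \<open>P\<^sub>2\<close> on one side of \<open>e\<close> and \<open>P\<^sub>3\<close> from \<open>P\<^sub>1\<close> on the other; up to reversing the order of the
  four paths, \<open>P\<^sub>0\<close> also diverges from \<open>P\<^sub>3\<close> on the first side. The fifth path is then forced to
  run on the other side only, to miss \<open>P\<^sub>2\<close> and to follow \<open>P\<^sub>3\<close> past its divergence from \<open>P\<^sub>1\<close>.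
  This leaves six edges, on which the five paths have the same incidences as in the canonical
  representation, and contracting all other edges of the tree produces the canonical
  representation. Conversely, every edge of the canonical tree and of its paths is needed for some
  intersection or some splitting vertex.
\<close>

section \<open>Edge sets of paths\<close>

text \<open>Uniqueness needs no analysis of minimal representations. The six edges are found in
  every representation that fits the labelling, contractions alone lead from it to a representation
  isomorphic to the canonical one, and minimality turns this into an isomorphism with the starting
  point. End removals therefore matter only for the minimality of the canonical representation
  itself. The obstacle is the fifth path: it avoids \<open>e\<close>, so it has no arms at
  \<open>e\<close> and cannot be compared with the others directly. It is first placed as a tail of
  a word that starts at \<open>e\<close>; after that all five paths live in one prefix order.
  Whether the fifth vertex is adjacent to the inner vertices of the four-vertex path is unknown at
  the start. It is read off at the end: \<open>f\<close> lies on the fifth path and on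
  \<open>P\<^sub>1\<close>, and disjointness from \<open>P\<^sub>2\<close> gives the single missing
  edge. Thus the labelling is found together with the six edges.\<close>

lemma path_edges_append: "path_edges (xs @ y # ys) = path_edges (xs @ [y]) \<union> path_edges (y # ys)"
proof (induction xs)
  case (Cons a xs)
  then show ?case by (cases xs) auto
qed simp

lemma path_edges_split:
  "path_edges (xs @ x # y # ys) = path_edges (xs @ [x]) \<union> {{x, y}} \<union> path_edges (y # ys)"
  by (subst path_edges_append) auto

lemma path_edges_snoc: "path_edges (xs @ [x, y]) = insert {x, y} (path_edges (xs @ [x]))"
  by (subst path_edges_split) simp

lemma path_edges_rev [simp]: "path_edges (rev xs) = path_edges xs"
proof (induction xs rule: path_edges.induct)
  case (1 x y xs)
  then show ?case using path_edges_snoc[of "rev xs" y x] by (simp add: insert_commute)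
qed auto

lemma path_edges_map: "path_edges (map f xs) = (`) f ` path_edges xs"
  by (induction xs rule: path_edges.induct) auto

lemma path_edges_subset_set: "e \<in> path_edges xs \<Longrightarrow> e \<subseteq> set xs"
  by (induction xs rule: path_edges.induct) auto

lemma path_edges_nonempty: "e \<in> path_edges xs \<Longrightarrow> e \<noteq> {}"
  by (induction xs rule: path_edges.induct) auto

lemma finite_path_edges [simp]: "finite (path_edges xs)"
  by (induction xs rule: path_edges.induct) auto

lemma in_path_edges_decomp:
  "e \<in> path_edges xs \<Longrightarrow> \<exists>as x y bs. xs = as @ x # y # bs \<and> e = {x, y}"
proof (induction xs rule: path_edges.induct)
  case (1 x y xs)
  show ?case
  proof (cases "e = {x, y}")
    case True
    then show ?thesis by (metis append_Nil)
  next
    case False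
    with 1 show ?thesis by (metis append_Cons insert_iff path_edges.simps(1))
  qed
qed auto

lemma path_edges_append_mono: "path_edges xs \<subseteq> path_edges (xs @ ys)"
proof (cases xs rule: rev_cases)
  case (snoc zs z)
  then show ?thesis using path_edges_append[of zs z ys] by auto
qed simp

lemma path_edges_append_mono': "path_edges ys \<subseteq> path_edges (xs @ ys)"
  using path_edges_append_mono[of "rev ys" "rev xs"] by (metis path_edges_rev rev_append)

lemma path_edges_mono_prefix: "prefix xs ys \<Longrightarrow> path_edges xs \<subseteq> path_edges ys"
  using path_edges_append_mono by (auto simp: prefix_def)

text \<open>For the first or last vertex of the list, \<open>last []\<close> or \<open>hd []\<close>
  is unspecified. The statement is only an upper bound, so the spurious candidate does no
  harm.\<close>

lemma path_edges_at:
  assumes "distinct (as @ v # bs)" "e \<in> path_edges (as @ v # bs)" "v \<in> e"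
  shows "e \<in> {{last as, v}, {v, hd bs}}"
proof -
  have "e \<in> path_edges (as @ [v]) \<or> e \<in> path_edges (v # bs)"
    using assms(2) path_edges_append[of as v bs] by simp
  then show ?thesis
  proof
    assume e: "e \<in> path_edges (as @ [v])"
    show ?thesis
    proof (cases as rule: rev_cases)
      case (snoc cs c)
      then have "e = {c, v} \<or> e \<in> path_edges (cs @ [c])"
        using e path_edges_snoc[of cs c v] by auto
      moreover have "v \<notin> set (cs @ [c])" using assms(1) snoc by auto
      then have "e \<notin> path_edges (cs @ [c])" using assms(3) path_edges_subset_set by blast
      ultimately show ?thesis using snoc by simp
    qed (use e in simp)
  next
    assume e: "e \<in> path_edges (v # bs)"
    show ?thesis
    proof (cases bs)
      case (Cons c cs)
      then have "e = {v, c} \<or> e \<in> path_edges (c # cs)" using e by auto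
      moreover have "v \<notin> set (c # cs)" using assms(1) Cons by auto
      then have "e \<notin> path_edges (c # cs)" using assms(3) path_edges_subset_set by blast
      ultimately show ?thesis using Cons by simp
    qed (use e in simp)
  qed
qed

text \<open>Degrees inside a single path are at most 2. Exhibiting one path that contains both
  \<open>P\<close> and \<open>Q\<close> is how nonsplitting pairs are produced later.\<close>

lemma split_vertices_within_path:
  assumes "distinct zs" "P \<union> Q \<subseteq> path_edges zs"
  shows "split_vertices P Q = {}"
proof -
  have "card {e \<in> P \<union> Q. v \<in> e} \<le> 2" for v
  proof (cases "v \<in> set zs")
    case True
    then obtain as bs where zs: "zs = as @ v # bs" by (meson split_list)
    have "{e \<in> P \<union> Q. v \<in> e} \<subseteq> {{last as, v}, {v, hd bs}}"
      using path_edges_at[of as v bs] assms unfolding zs by auto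
    then have "card {e \<in> P \<union> Q. v \<in> e} \<le> card {{last as, v}, {v, hd bs}}"
      by (intro card_mono) auto
    also have "\<dots> \<le> 2" by (simp add: card_insert_if)
    finally show ?thesis .
  next
    case False
    then have "{e \<in> P \<union> Q. v \<in> e} = {}" using assms path_edges_subset_set by blast
    then show ?thesis by (metis card.empty zero_le)
  qed
  then have "\<not> 3 \<le> card {e \<in> P \<union> Q. v \<in> e}" for v
    by (metis Suc_n_not_le_n eval_nat_numeral(3) le_trans)
  then show ?thesis unfolding split_vertices_def by blast
qed

text \<open>Finiteness enters because \<open>card\<close> of an infinite set is 0.\<close>

lemma split_vertices_nonempty:
  assumes "finite P" "finite Q" "e1 \<in> P \<union> Q" "e2 \<in> P \<union> Q" "e3 \<in> P \<union> Q"
    "distinct [e1, e2, e3]" "v \<in> e1" "v \<in> e2" "v \<in> e3"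
  shows "split_vertices P Q \<noteq> {}"
proof -
  have "card {e1, e2, e3} \<le> card {e \<in> P \<union> Q. v \<in> e}"
    using assms by (intro card_mono) auto
  then have "v \<in> split_vertices P Q" using assms(6) by (simp add: split_vertices_def)
  then show ?thesis by blast
qed

lemma split_vertices_commute: "split_vertices P Q = split_vertices Q P"
  by (simp add: split_vertices_def Un_commute)

lemma intersecting_commute: "intersecting P Q = intersecting Q P"
  by (auto simp: intersecting_def)

lemma nonsplitting_commute: "nonsplitting P Q = nonsplitting Q P"
  by (simp add: nonsplitting_def split_vertices_commute intersecting_commute)

text \<open>Consecutive edges share a vertex, so a path cannot jump between vertex-disjoint edge
  sets. This keeps the inner edges of the canonical path of \<open>v3\<close> in place once its two
  ends are known to survive.\<close>

lemma path_edges_within_one_part: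
  assumes "path_edges xs \<subseteq> A \<union> B" "\<Union>A \<inter> \<Union>B = {}"
  shows "path_edges xs \<subseteq> A \<or> path_edges xs \<subseteq> B"
  using assms(1)
proof (induction xs rule: path_edges.induct)
  case (1 x y xs)
  then have IH: "path_edges (y # xs) \<subseteq> A \<or> path_edges (y # xs) \<subseteq> B" by auto
  have xy: "{x, y} \<in> A \<or> {x, y} \<in> B" using 1(2) by auto
  show ?case
  proof (cases xs)
    case Nil
    then show ?thesis using xy by auto
  next
    case (Cons z zs)
    then have "{y, z} \<in> path_edges (y # xs)" by simp
    then have "{x, y} \<in> A \<longleftrightarrow> path_edges (y # xs) \<subseteq> A" "{x, y} \<in> B \<longleftrightarrow> path_edges (y # xs) \<subseteq> B"
      using IH xy assms(2) by blast+
    then show ?thesis using xy by auto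
  qed
qed auto

text \<open>Both lists follow the same word up to \<open>last (y # l)\<close>. An occurrence of the
  edge before the branch would repeat \<open>c\<close> in the second list; one behind it would
  repeat the branch vertex in the first.\<close>

lemma branch_edge_not_on_path:
  assumes "distinct (zs @ y # l @ d # X)" "distinct (zs @ y # l @ c # Y)" "c \<noteq> d"
  shows "{last (y # l), c} \<notin> path_edges (zs @ y # l @ d # X)"
proof -
  obtain as t where as: "y # l = as @ [t]" by (metis list.discI rev_exhaust)
  have eq: "zs @ y # l @ d # X = (zs @ as) @ t # d # X"
    using as by (metis append.assoc append_Cons append_Nil)
  have "distinct ((zs @ as) @ t # c # Y)"
    using as assms(2) by (metis append.assoc append_Cons append_Nil)
  then have c: "c \<notin> set ((zs @ as) @ [t])" by auto
  have t: "t \<notin> set (d # X)" using assms(1) unfolding eq by auto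
  have "{t, c} \<notin> path_edges ((zs @ as) @ t # d # X)"
    unfolding path_edges_split
    using c t assms(3) path_edges_subset_set[of "{t, c}" "(zs @ as) @ [t]"]
      path_edges_subset_set[of "{t, c}" "d # X"]
    by (auto simp: doubleton_eq_iff simp del: append_assoc)
  then show ?thesis unfolding eq as by simp
qed

section \<open>Reachability and bridges\<close>

text \<open>Walks instead of simple paths: they compose without any distinctness bookkeeping, and
  only the edge set, from which edges get deleted, is mentioned.\<close>

definition joined :: "'a set set \<Rightarrow> 'a \<Rightarrow> 'a \<Rightarrow> bool" where
  "joined E = (\<lambda>x y. {x, y} \<in> E)\<^sup>*\<^sup>*"

lemma joined_refl [simp]: "joined E x x"
  by (simp add: joined_def)

lemma joined_trans [trans]: "joined E x y \<Longrightarrow> joined E y z \<Longrightarrow> joined E x z"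
  by (simp add: joined_def)

lemma joined_step: "joined E x y \<Longrightarrow> {y, z} \<in> E \<Longrightarrow> joined E x z"
  unfolding joined_def by (rule rtranclp.rtrancl_into_rtrancl)

lemma joined_induct [consumes 1, case_names refl step]:
  assumes "joined E x z" "Q x" "\<And>y z. joined E x y \<Longrightarrow> {y, z} \<in> E \<Longrightarrow> Q y \<Longrightarrow> Q z"
  shows "Q z"
  using assms(1) unfolding joined_def
  by (induction rule: rtranclp_induct) (use assms in \<open>auto simp: joined_def\<close>)

lemma joined_sym: "joined E x y \<Longrightarrow> joined E y x"
proof (induction rule: joined_induct)
  case (step y z)
  have "joined E z y" by (rule joined_step[of _ z z]) (use step in \<open>auto simp: insert_commute\<close>)
  then show ?case using step joined_trans by metis
qed simp

lemma joined_mono: "joined E x y \<Longrightarrow> E \<subseteq> E' \<Longrightarrow> joined E' x y"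
  by (induction rule: joined_induct) (auto intro: joined_step)

lemma joined_empty: "joined {} x y \<Longrightarrow> x = y"
  by (induction rule: joined_induct) auto

lemma joined_path: "path_edges (x # xs) \<subseteq> E \<Longrightarrow> z \<in> set (x # xs) \<Longrightarrow> joined E x z"
proof (induction xs arbitrary: x)
  case (Cons a xs)
  have "joined E x a" by (rule joined_step[of _ x x]) (use Cons in auto)
  then show ?case using Cons joined_trans by (metis insert_iff insert_subset joined_refl
      list.set(2) path_edges.simps(1))
qed simp

lemma joined_on_path:
  assumes "path_edges xs \<subseteq> E" "y \<in> set xs" "z \<in> set xs"
  shows "joined E y z"
proof (cases xs)
  case (Cons x ys)
  then show ?thesis using joined_path[of x ys E] assms joined_sym joined_trans by metis
qed (use assms in simp)

lemma joined_cut: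
  assumes "joined D u v" "\<And>u v. {u, v} \<in> D \<Longrightarrow> u \<in> X \<longleftrightarrow> v \<in> X"
  shows "u \<in> X \<longleftrightarrow> v \<in> X"
  using assms(1) by (induction rule: joined_induct) (use assms(2) in auto)

lemma joined_imp_path:
  assumes "joined E x y"
  shows "\<exists>xs. xs \<noteq> [] \<and> distinct xs \<and> hd xs = x \<and> last xs = y \<and> path_edges xs \<subseteq> E"
  using assms
proof (induction rule: joined_induct)
  case refl
  show ?case by (rule exI[of _ "[x]"]) simp
next
  case (step y z)
  then obtain xs where xs: "xs \<noteq> []" "distinct xs" "hd xs = x" "last xs = y" "path_edges xs \<subseteq> E"
    by blast
  show ?case
  proof (cases "z \<in> set xs")
    case True
    then obtain as bs where eq: "xs = as @ z # bs" by (meson split_list)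
    have "path_edges (as @ [z]) \<subseteq> E" using xs(5) unfolding eq path_edges_append[of as z bs] by auto
    then show ?thesis using xs unfolding eq
      by (intro exI[of _ "as @ [z]"]) (auto simp: hd_append split: if_splits)
  next
    case False
    obtain cs where cs: "xs = cs @ [y]" using xs by (metis append_butlast_last_id)
    have "path_edges (xs @ [z]) \<subseteq> E" using path_edges_snoc[of cs y z] xs step cs by auto
    then show ?thesis using xs False by (intro exI[of _ "xs @ [z]"]) auto
  qed
qed

text \<open>The rest of a cycle through \<open>{x, y}\<close> is a walk from \<open>y\<close> to
  \<open>x\<close> avoiding this edge, which a cut separating them forbids. For a concrete tree,
  acyclicity is thus reduced to naming one cut per edge.\<close>

lemma cut_edges_imp_acyclic:
  assumes cut: "\<And>x y. {x, y} \<in> E \<Longrightarrow> x \<noteq> y \<Longrightarrow> \<exists>X. y \<in> X \<and> x \<notin> X \<and>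
      (\<forall>u v. {u, v} \<in> E \<longrightarrow> {u, v} \<noteq> {x, y} \<longrightarrow> (u \<in> X \<longleftrightarrow> v \<in> X))"
    and C: "cycle_graph C" "edges C \<subseteq> E"
  shows False
proof -
  obtain xs where xs: "length xs \<ge> 3" "distinct xs" "edges C = cycle_edges xs"
    using C(1) by (auto simp: cycle_graph_def)
  then obtain x y z zs where eq: "xs = x # y # z # zs"
    by (metis One_nat_def Suc_le_length_iff numeral_3_eq_3)
  have sub: "path_edges (x # y # z # zs @ [x]) \<subseteq> E"
    using C(2) xs(3) by (simp add: eq cycle_edges_def)
  have "{x, y} \<in> E" "x \<noteq> y" using sub xs(2) eq by auto
  from cut[OF this] obtain X where X: "y \<in> X" "x \<notin> X"
    "\<And>u v. {u, v} \<in> E \<Longrightarrow> {u, v} \<noteq> {x, y} \<Longrightarrow> u \<in> X \<longleftrightarrow> v \<in> X" by blast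
  have "{x, y} \<notin> path_edges (y # z # zs @ [x])"
  proof -
    have "distinct ([] @ y # z # zs @ [x])" using xs(2) eq by auto
    from path_edges_at[OF this, of "{x, y}"] show ?thesis using xs(2) eq
        path_edges_subset_set[of "{x, y}" "z # zs @ [x]"] by (auto simp: doubleton_eq_iff)
  qed
  then have "path_edges (y # z # zs @ [x]) \<subseteq> E - {{x, y}}" using sub by auto
  from joined_path[OF this, of x] have "joined (E - {{x, y}}) y x" by simp
  from joined_cut[OF this, of X] X show False by auto
qed

section \<open>Paths in a tree\<close>

definition is_path :: "'a graph \<Rightarrow> 'a set set \<Rightarrow> bool" where
  "is_path T P \<longleftrightarrow> (\<exists>xs. simple_path T xs \<and> length xs \<ge> 2 \<and> P = path_edges xs)"

text \<open>Both \<open>L\<close> and \<open>R\<close> are read outwards from the edge, hence the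
  \<open>rev\<close>. Shortening the path at an end then means taking a prefix of an arm.\<close>

definition arms :: "'a graph \<Rightarrow> 'a \<Rightarrow> 'a \<Rightarrow> 'a set set \<Rightarrow> 'a list \<Rightarrow> 'a list \<Rightarrow> bool" where
  "arms T x y P L R \<longleftrightarrow> simple_path T (rev L @ x # y # R) \<and> P = path_edges (rev L @ x # y # R)"

lemma simple_path_rev: "simple_path T (rev xs) \<longleftrightarrow> simple_path T xs"
  by (simp add: simple_path_def)

lemma simple_path_appendD:
  assumes "simple_path T (xs @ ys)"
  shows "xs \<noteq> [] \<Longrightarrow> simple_path T xs" "ys \<noteq> [] \<Longrightarrow> simple_path T ys"
  using assms path_edges_append_mono[of xs ys] path_edges_append_mono'[of ys xs]
  by (auto simp: simple_path_def)

lemma arms_swap: "arms T x y P L R \<longleftrightarrow> arms T y x P R L"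
proof -
  have "rev R @ y # x # L = rev (rev L @ x # y # R)" by simp
  then show ?thesis unfolding arms_def by (metis path_edges_rev simple_path_rev)
qed

lemma arms_exist:
  assumes "is_path T P" "{x, y} \<in> P"
  obtains L R where "arms T x y P L R"
proof -
  obtain xs where xs: "simple_path T xs" "P = path_edges xs"
    using assms(1) by (auto simp: is_path_def)
  then obtain as a b bs where eq: "xs = as @ a # b # bs" "{x, y} = {a, b}"
    using assms(2) in_path_edges_decomp by metis
  then have *: "arms T a b P (rev as) bs" using xs by (simp add: arms_def)
  have "arms T x y P (rev as) bs \<or> arms T x y P bs (rev as)"
    using * eq(2) arms_swap[of T a b] by (auto simp: doubleton_eq_iff)
  then show ?thesis using that by blast
qed

lemma arms_edges:
  assumes "arms T x y P L R"
  shows "P = path_edges (x # L) \<union> {{x, y}} \<union> path_edges (y # R)"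
proof -
  have "path_edges (rev L @ [x]) = path_edges (x # L)" by (metis path_edges_rev rev.simps(2))
  then show ?thesis using assms by (simp add: arms_def path_edges_split)
qed

lemma arms_is_path: "arms T x y P L R \<Longrightarrow> is_path T P"
  unfolding arms_def is_path_def by (rule exI[of _ "rev L @ x # y # R"]) simp

text \<open>Where two arms diverge three edges meet: the common one leading there and the two
  different continuations.\<close>

lemma arms_nonsplitting_right:
  assumes P: "arms T x y P L R" and Q: "arms T x y Q L' R'" and ns: "nonsplitting P Q"
  shows "\<not> R \<parallel> R'"
proof
  assume "R \<parallel> R'"
  then obtain l a A b B where ab: "a \<noteq> b" "R = l @ a # A" "R' = l @ b # B"
    using parallel_decomp by blast
  \<comment> \<open>\<open>t\<close> is the vertex of divergence and \<open>p\<close> its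
    predecessor, which exists even for \<open>l = []\<close> because \<open>x # y\<close> precedes
    \<open>l\<close>.\<close>
  obtain as p t where as: "rev L @ x # y # l = as @ [p, t]"
    by (metis append.assoc append_Cons append_Nil rev_exhaust append_butlast_last_id list.discI
        snoc_eq_iff_butlast)
  \<comment> \<open>\<open>p\<close> and \<open>t\<close> lie in the shared part
    \<open>x # y # l\<close>, so they are the same in the second list, whatever its left arm
    is.\<close>
  obtain as' where as': "rev L' @ x # y # l = as' @ [p, t]"
  proof (cases l rule: rev_cases)
    case Nil
    then show ?thesis using as that[of "rev L'"] by simp
  next
    case (snoc l1 z)
    show ?thesis
    proof (cases l1 rule: rev_cases)
      case Nil
      then show ?thesis using as snoc that[of "rev L' @ [x]"] by simp
    next
      case (snoc l2 z')
      then show ?thesis using as \<open>l = l1 @ [z]\<close> that[of "rev L' @ x # y # l2"] by simp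
    qed
  qed
  have Pl: "rev L @ x # y # R = (as @ [p]) @ t # a # A" and Ql: "rev L' @ x # y # R' = (as' @ [p]) @ t # b # B"
    using as as' ab by (metis append.assoc append_Cons append_Nil)+
  have P': "P = path_edges ((as @ [p]) @ t # a # A)" "distinct ((as @ [p]) @ t # a # A)"
    and Q': "Q = path_edges ((as' @ [p]) @ t # b # B)" "distinct ((as' @ [p]) @ t # b # B)"
    using P Q unfolding arms_def Pl Ql by (auto simp: simple_path_def)
  have e: "{t, a} \<in> P" "{t, b} \<in> Q" unfolding P' Q' path_edges_split by auto
  have "{p, t} \<in> P" unfolding P' using path_edges_split[of as p t "a # A"] by simp
  moreover have "distinct [{p, t}, {t, a}, {t, b}]" using P'(2) Q'(2) ab(1)
    by (auto simp: doubleton_eq_iff)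
  ultimately have "split_vertices P Q \<noteq> {}"
    using e P'(1) Q'(1) by (intro split_vertices_nonempty[of P Q "{p, t}" "{t, a}" "{t, b}" t]) auto
  then show False using ns by (simp add: nonsplitting_def)
qed

lemma arms_nonsplitting:
  assumes "arms T x y P L R" "arms T x y Q L' R'" "nonsplitting P Q"
  shows "\<not> L \<parallel> L'" "\<not> R \<parallel> R'"
  using assms arms_nonsplitting_right arms_swap by metis+

section \<open>Comparable and parallel words\<close>

lemma prefix_not_parallel: "prefix xs ys \<Longrightarrow> \<not> ys \<parallel> zs \<Longrightarrow> \<not> xs \<parallel> zs"
  by (meson not_equal_is_parallel parallel_def prefix_order.trans prefix_same_cases prefix_order.eq_refl)

lemma not_parallel_sym: "\<not> xs \<parallel> ys \<Longrightarrow> \<not> ys \<parallel> xs"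
  by (auto simp: parallel_def)

lemma not_parallel_cases: "\<not> xs \<parallel> ys \<Longrightarrow> prefix xs ys \<or> prefix ys xs"
  by (auto simp: parallel_def)

text \<open>A word comparable to two diverging words has to stop no later than the place where they
  diverge. Most case distinctions below come down to this.\<close>

lemma comparable_to_parallel:
  assumes "xs \<parallel> ys" "\<not> zs \<parallel> xs" "\<not> zs \<parallel> ys"
  shows "prefix zs xs \<and> prefix zs ys"
  using assms by (metis not_parallel_cases not_parallel_sym prefix_not_parallel)

text \<open>\<open>zs\<close> diverges from \<open>xs\<close> but is comparable to
  \<open>ys\<close>, so it takes the letter \<open>b\<close> after the common part \<open>l\<close>,
  even if it ends before \<open>ys\<close> does.\<close>

lemma parallel_branch:
  assumes "xs \<parallel> ys" "\<not> ys \<parallel> zs" "xs \<parallel> zs"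
  obtains l a A b B Z where "a \<noteq> b" "xs = l @ a # A" "ys = l @ b # B" "zs = l @ b # Z"
proof -
  obtain l a A b B where ab: "a \<noteq> b" "xs = l @ a # A" "ys = l @ b # B"
    using assms(1) parallel_decomp by blast
  have "prefix (l @ [b]) zs"
  proof (cases "prefix zs ys")
    case True
    have "\<not> prefix zs l" using assms(3) ab(2) by (auto simp: parallel_def prefix_def)
    moreover have "prefix zs (l @ b # B)" using True ab by simp
    ultimately show ?thesis by (metis prefix_append append_Cons append_Nil prefix_Cons
       prefix_def append.assoc append_Nil2 same_prefix_prefix)
  next
    case False
    then have "prefix ys zs" using assms(2) by (auto simp: parallel_def)
    then show ?thesis using ab by (metis append.assoc append_Cons append_Nil append_prefixD)
  qed
  then obtain Z where "zs = l @ b # Z" by (auto simp: prefix_def)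
  then show ?thesis using that ab by blast
qed

section \<open>Bridges, sides and uniqueness of paths in a tree\<close>

locale tree_graph =
  fixes T :: "'a graph"
  assumes tree: "tree T"
begin

abbreviation "E \<equiv> edges T"

lemma edge_verts: "{x, y} \<in> E \<Longrightarrow> x \<in> verts T \<and> y \<in> verts T \<and> x \<noteq> y"
  using tree by (fastforce simp: tree_def simple_graph_def)

lemma joined_all:
  assumes "x \<in> verts T" "y \<in> verts T"
  shows "joined E x y"
proof -
  obtain xs where "simple_path T xs" "hd xs = x" "last xs = y"
    using assms tree unfolding tree_def connected_graph_def by blast
  then show ?thesis by (intro joined_on_path[of xs]) (auto simp: simple_path_def)
qed

text \<open>A simple path from \<open>x\<close> to \<open>y\<close> around the edge would close up
  with it to a cycle.\<close>

lemma bridge: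
  assumes "{x, y} \<in> E"
  shows "\<not> joined (E - {{x, y}}) x y"
proof
  assume "joined (E - {{x, y}}) x y"
  then obtain xs where xs: "xs \<noteq> []" "distinct xs" "hd xs = x" "last xs = y"
      "path_edges xs \<subseteq> E - {{x, y}}"
    using joined_imp_path by metis
  have "x \<noteq> y" using edge_verts assms by blast
  then obtain z zs where zs: "xs = x # z # zs" using xs by (cases xs; cases "tl xs") auto
  have "zs \<noteq> []" using zs xs by auto
  then have len: "length xs \<ge> 3" using zs by (cases zs) auto
  obtain cs where cs: "xs = cs @ [y]" using xs by (metis append_butlast_last_id)
  have "cycle_edges xs = insert {y, x} (path_edges xs)"
    using path_edges_snoc[of cs y x] xs cs by (simp add: cycle_edges_def)
  then have sub: "cycle_edges xs \<subseteq> E" using xs assms by (auto simp: insert_commute)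
  \<comment> \<open>\<open>joined\<close> speaks of edges only, so membership in the vertex set is
    recovered by following the path from \<open>x\<close>.\<close>
  have "set xs \<subseteq> verts T"
  proof
    fix v assume "v \<in> set xs"
    then have "joined E x v"
      using xs zs by (intro joined_on_path[of xs]) auto
    then show "v \<in> verts T"
      by (induction rule: joined_induct) (use assms edge_verts in auto)
  qed
  then have "subgraph \<lparr>verts = set xs, edges = cycle_edges xs\<rparr> T"
    using sub by (simp add: subgraph_def)
  moreover have "cycle_graph \<lparr>verts = set xs, edges = cycle_edges xs\<rparr>"
    using xs len by (auto simp: cycle_graph_def)
  ultimately show False using tree by (auto simp: tree_def)
qed

lemma cut:
  assumes "{x, y} \<in> E"
  obtains X where "y \<in> X" "x \<notin> X"
    "\<And>u v. {u, v} \<in> E \<Longrightarrow> {u, v} \<noteq> {x, y} \<Longrightarrow> u \<in> X \<longleftrightarrow> v \<in> X"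
proof
  let ?X = "{z. joined (E - {{x, y}}) y z}"
  show "y \<in> ?X" by simp
  show "x \<notin> ?X" using bridge[OF assms] joined_sym by fastforce
  show "u \<in> ?X \<longleftrightarrow> v \<in> ?X" if "{u, v} \<in> E" "{u, v} \<noteq> {x, y}" for u v
    using that joined_step[of "E - {{x, y}}" y u v] joined_step[of "E - {{x, y}}" y v u]
    by (auto simp: insert_commute)
qed

text \<open>The first argument names the end that belongs to the component.\<close>

definition side :: "'a \<Rightarrow> 'a \<Rightarrow> 'a set" where
  "side x y = {z. joined (E - {{x, y}}) x z}"

lemma side_disjoint: "{x, y} \<in> E \<Longrightarrow> side x y \<inter> side y x = {}"
  using bridge[of x y] joined_sym joined_trans by (fastforce simp: side_def insert_commute)

lemma side_cover:
  assumes "{x, y} \<in> E" "z \<in> verts T"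
  shows "z \<in> side x y \<union> side y x"
proof -
  have "joined E x z" using joined_all edge_verts assms by blast
  then show ?thesis
  proof (induction rule: joined_induct)
    case (step u v)
    show ?case
    proof (cases "{u, v} = {x, y}")
      case True
      then show ?thesis by (auto simp: side_def doubleton_eq_iff)
    next
      case False
      then show ?thesis using step
        by (auto simp: side_def insert_commute intro: joined_step)
    qed
  qed (simp add: side_def)
qed

lemma side_path:
  assumes "path_edges xs \<subseteq> E - {{x, y}}" "z \<in> set xs" "z \<in> side x y"
  shows "set xs \<subseteq> side x y"
  using joined_on_path[OF assms(1,2)] assms(3) joined_trans by (fastforce simp: side_def)

lemma one_side:
  assumes "{x, y} \<in> E" "is_path T P" "{x, y} \<notin> P"
  shows "\<Union>P \<subseteq> side x y \<or> \<Union>P \<subseteq> side y x"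
proof -
  obtain xs where xs: "simple_path T xs" "P = path_edges xs"
    using assms(2) by (auto simp: is_path_def)
  then obtain z where z: "z \<in> set xs" "z \<in> verts T" by (cases xs) (auto simp: simple_path_def)
  have sub: "path_edges xs \<subseteq> E - {{x, y}}" "path_edges xs \<subseteq> E - {{y, x}}"
    using xs assms(3) by (auto simp: simple_path_def insert_commute)
  have "set xs \<subseteq> side x y \<or> set xs \<subseteq> side y x"
    using side_cover[OF assms(1) z(2)] side_path[OF sub(1) z(1)] side_path[OF sub(2) z(1)] by auto
  then show ?thesis using xs path_edges_subset_set[of _ xs] by blast
qed

lemma simple_path_side:
  assumes "simple_path T (x # y # R)"
  shows "set (y # R) \<subseteq> side y x"
proof (rule side_path)
  show "y \<in> side y x" by (simp add: side_def)
  show "path_edges (y # R) \<subseteq> E - {{y, x}}"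
    using assms path_edges_subset_set[of "{y, x}" "y # R"] by (auto simp: simple_path_def)
qed simp

lemma simple_path_edge: "simple_path T (x # y # R) \<Longrightarrow> {x, y} \<in> E"
  by (simp add: simple_path_def)

text \<open>The two parts lie on opposite sides of the bridge \<open>{x, y}\<close> and cannot meet
  again. Consequently any left arm at an edge can be combined with any right arm, whichever paths
  they come from.\<close>

lemma simple_path_join:
  assumes "simple_path T (as @ [x, y])" "simple_path T (x # y # bs)"
  shows "simple_path T (as @ x # y # bs)"
proof -
  have "simple_path T (y # x # rev as)" using assms(1) simple_path_rev[of T "as @ [x, y]"] by simp
  from simple_path_side[OF this] have "set (as @ [x]) \<subseteq> side x y" by auto
  moreover have "set (y # bs) \<subseteq> side y x" using simple_path_side assms(2) by blast
  ultimately have "set (as @ [x]) \<inter> set (y # bs) = {}"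
    using side_disjoint[OF simple_path_edge[OF assms(2)]] by blast
  then show ?thesis using assms path_edges_split[of as x y bs] path_edges_snoc[of as x y]
    by (auto simp: simple_path_def)
qed

lemma simple_path_unique:
  assumes "simple_path T xs" "simple_path T ys" "hd xs = hd ys" "last xs = last ys"
  shows "xs = ys"
  using assms
proof (induction xs arbitrary: ys)
  case (Cons x xs)
  then obtain ys' where ys: "ys = x # ys'" by (cases ys) (auto simp: simple_path_def)
  show ?case
  proof (cases "xs = [] \<or> ys' = []")
    case True
    then show ?thesis using Cons ys by (auto simp: simple_path_def split: if_splits)
  next
    case False
    then obtain a as b bs where ab: "xs = a # as" "ys' = b # bs" by (meson neq_Nil_conv)
    \<comment> \<open>With different first steps, \<open>xs\<close> ends beyond the bridge
      \<open>{x, a}\<close>, whereas \<open>ys\<close> never crosses it.\<close>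
    have "a = b"
    proof (rule ccontr)
      assume "a \<noteq> b"
      have "last ys \<in> side a x"
        using simple_path_side[of x a as] Cons.prems(1,4) ab last_in_set[of xs] by auto
      moreover have "set ys \<subseteq> side x a"
      proof (rule side_path)
        show "path_edges ys \<subseteq> E - {{x, a}}"
          using Cons.prems(2) path_edges_subset_set[of "{x, a}" "b # bs"] \<open>a \<noteq> b\<close> ys ab
          by (auto simp: simple_path_def doubleton_eq_iff)
        show "x \<in> set ys" "x \<in> side x a" using ys by (auto simp: side_def)
      qed
      moreover have "{x, a} \<in> E" using Cons.prems(1) ab simple_path_edge by blast
      moreover have "last ys \<in> set ys" using ys by simp
      ultimately show False using side_disjoint by blast
    qed
    moreover have "simple_path T xs" "simple_path T ys'"
      using Cons.prems simple_path_appendD(2)[of T "[x]"] ys ab by auto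
    ultimately have "xs = ys'" using Cons.IH[of ys'] Cons.prems(4) ys ab by simp
    then show ?thesis using ys by simp
  qed
qed (simp add: simple_path_def)

lemma arms_join:
  assumes "arms T x y P L R" "arms T x y Q L' R'"
  shows "simple_path T (rev L @ x # y # R')"
proof (rule simple_path_join)
  show "simple_path T (rev L @ [x, y])"
    using assms(1) simple_path_appendD(1)[of T "rev L @ [x, y]" R] by (simp add: arms_def)
  show "simple_path T (x # y # R')"
    using assms(2) simple_path_appendD(2)[of T "rev L'" "x # y # R'"] by (simp add: arms_def)
qed

lemma arms_side:
  assumes "arms T x y P L R"
  shows "set (y # R) \<subseteq> side y x" "set (x # L) \<subseteq> side x y"
proof -
  have *: "simple_path T (x # y # R)" if "arms T x y P L R" for x y L R
    using that simple_path_appendD(2)[of T "rev L" "x # y # R"] by (simp add: arms_def)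
  show "set (y # R) \<subseteq> side y x" using * assms simple_path_side by blast
  show "set (x # L) \<subseteq> side x y" using * assms simple_path_side arms_swap by metis
qed

lemma arms_in_E: "arms T x y P L R \<Longrightarrow> {x, y} \<in> E"
  by (auto simp: arms_def simple_path_def path_edges_split)

lemma arms_edge_on_side:
  assumes "arms T x y P L R" "f \<in> P" "f \<subseteq> side y x"
  shows "f \<in> path_edges (y # R)"
proof -
  have "f \<notin> path_edges (x # L)"
    using path_edges_subset_set[of f "x # L"] path_edges_nonempty[of f "x # L"] assms(3)
      arms_side[OF assms(1)] side_disjoint[OF arms_in_E[OF assms(1)]] by blast
  moreover have "f \<noteq> {x, y}"
    using assms(3) arms_side[OF assms(1)] side_disjoint[OF arms_in_E[OF assms(1)]] by auto
  ultimately show ?thesis using assms(2) arms_edges[OF assms(1)] by blast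
qed

section \<open>Helly properties for paths sharing edges\<close>

lemma not_parallel_common_edge:
  assumes "\<not> R \<parallel> R'" "f \<in> path_edges (y # R)" "f' \<in> path_edges (y # R')"
  shows "(f \<in> path_edges (y # R') \<and> prefix R R') \<or> (f' \<in> path_edges (y # R) \<and> prefix R' R)"
  using assms not_parallel_cases path_edges_mono_prefix[of "y # R" "y # R'"]
    path_edges_mono_prefix[of "y # R'" "y # R"] by auto

text \<open>Pairwise sharing of edges is not enough: the three paths formed by two legs of a claw
  have no common edge. If \<open>P\<close> and \<open>Q\<close> are nonsplitting and
  \<open>S\<close> misses a common edge of theirs, then \<open>S\<close> lies on one side of it,
  where the arms of \<open>P\<close> and \<open>Q\<close> are comparable; the edge that
  \<open>S\<close> shares with the shorter arm also lies on the longer one.\<close>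

lemma helly:
  assumes "is_path T P" "is_path T Q" "is_path T S" "nonsplitting P Q"
    "P \<inter> S \<noteq> {}" "Q \<inter> S \<noteq> {}"
  shows "P \<inter> Q \<inter> S \<noteq> {}"
proof (rule ccontr)
  assume none: "\<not> P \<inter> Q \<inter> S \<noteq> {}"
  obtain e where e: "e \<in> P" "e \<in> Q" using assms(4) by (auto simp: nonsplitting_def intersecting_def)
  then obtain x y where xy: "e = {x, y}" using assms(1) in_path_edges_decomp
    unfolding is_path_def by metis
  \<comment> \<open>Stated for arbitrary \<open>x\<close> and \<open>y\<close>, so that it serves
    both sides of the edge.\<close>
  have aux: False if ex: "e = {x, y}" and sub: "\<Union>S \<subseteq> side y x" for x y
  proof -
    obtain L R where P: "arms T x y P L R" using arms_exist assms(1) e ex by metis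
    obtain L' R' where Q: "arms T x y Q L' R'" using arms_exist assms(2) e ex by metis
    obtain f f' where f: "f \<in> P" "f \<in> S" "f' \<in> Q" "f' \<in> S" using assms(5,6) by blast
    have "f \<in> path_edges (y # R)" "f' \<in> path_edges (y # R')"
      using arms_edge_on_side P Q f sub by blast+
    then show False
      using not_parallel_common_edge[of R R' f y f'] arms_nonsplitting[OF P Q assms(4)] f none
        arms_edges[OF P] arms_edges[OF Q] by blast
  qed
  have "e \<in> E" using e(1) assms(1) by (auto simp: is_path_def simple_path_def)
  moreover have "e \<notin> S" using e none by blast
  ultimately show False using one_side[of x y S] assms(3) aux xy insert_commute by metis
qed

lemma helly_four:
  assumes "is_path T Q0" "is_path T Q1" "is_path T Q2" "is_path T Q3"
    and ns: "nonsplitting Q0 Q1" "nonsplitting Q1 Q2"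
    and int: "Q0 \<inter> Q2 \<noteq> {}" "Q0 \<inter> Q3 \<noteq> {}" "Q1 \<inter> Q3 \<noteq> {}" "Q2 \<inter> Q3 \<noteq> {}"
  obtains x y where "{x, y} \<in> Q0 \<inter> Q1 \<inter> Q2 \<inter> Q3"
proof -
  have "Q0 \<inter> Q1 \<inter> Q2 \<noteq> {}"
    using helly[of Q0 Q1 Q2] assms by (auto simp: nonsplitting_def intersecting_def)
  then obtain e where e: "e \<in> Q0" "e \<in> Q1" "e \<in> Q2" by blast
  then obtain x y where xy: "e = {x, y}" using assms(1) in_path_edges_decomp
    unfolding is_path_def by metis
  have "Q0 \<inter> Q1 \<inter> Q2 \<inter> Q3 \<noteq> {}"
  proof (rule ccontr)
    assume none: "\<not> Q0 \<inter> Q1 \<inter> Q2 \<inter> Q3 \<noteq> {}"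
    have aux: False if ex: "e = {x, y}" and sub: "\<Union>Q3 \<subseteq> side y x" for x y
    proof -
      obtain L0 R0 where Q0: "arms T x y Q0 L0 R0" using arms_exist assms(1) e ex by metis
      obtain L1 R1 where Q1: "arms T x y Q1 L1 R1" using arms_exist assms(2) e ex by metis
      obtain L2 R2 where Q2: "arms T x y Q2 L2 R2" using arms_exist assms(3) e ex by metis
      obtain f0 f1 f2 where f: "f0 \<in> Q0" "f0 \<in> Q3" "f1 \<in> Q1" "f1 \<in> Q3" "f2 \<in> Q2" "f2 \<in> Q3"
        using int by blast
      have fR: "f0 \<in> path_edges (y # R0)" "f1 \<in> path_edges (y # R1)" "f2 \<in> path_edges (y # R2)"
        using arms_edge_on_side Q0 Q1 Q2 f sub by blast+
      have np: "\<not> R0 \<parallel> R1" "\<not> R1 \<parallel> R2" using arms_nonsplitting Q0 Q1 Q2 ns by metis+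
      have none': "\<not> (g \<in> Q3 \<and> g \<in> path_edges (y # R0) \<and> g \<in> path_edges (y # R1) \<and> g \<in> path_edges (y # R2))" for g
        using none arms_edges[OF Q0] arms_edges[OF Q1] arms_edges[OF Q2] by blast
      have mono: "path_edges (y # A) \<subseteq> path_edges (y # B)" if "prefix A B" for A B
        using path_edges_mono_prefix[of "y # A" "y # B"] that by simp
      \<comment> \<open>The arms of \<open>Q0\<close> and \<open>Q2\<close> may diverge, but both
        are comparable to that of \<open>Q1\<close>. So one of the three arms is a prefix of the
        other two, and the edge it shares with \<open>Q3\<close> is common to all.\<close>
      have cases: "prefix R1 R0 \<and> prefix R1 R2 \<or> prefix R0 R1 \<and> prefix R0 R2 \<or> prefix R2 R0 \<and> prefix R2 R1"
        using np by (metis not_parallel_cases prefix_order.trans prefix_same_cases)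
      then show False using none'[of f0] none'[of f1] none'[of f2] f fR mono by blast
    qed
    have "e \<in> E" using e(1) assms(1) by (auto simp: is_path_def simple_path_def)
    moreover have "e \<notin> Q3" using e none by blast
    ultimately show False using one_side[of x y Q3] assms(4) aux xy insert_commute by metis
  qed
  then obtain e' where e': "e' \<in> Q0 \<inter> Q1 \<inter> Q2 \<inter> Q3" by blast
  then obtain u v where "e' = {u, v}" using assms(1) in_path_edges_decomp
    unfolding is_path_def by (metis IntD1)
  then show ?thesis using that e' by blast
qed

text \<open>Places a path that avoids the base edge as a tail of a word \<open>W\<close> starting
  there. The base is moved to the shared edge \<open>f\<close>: going backwards from
  \<open>f\<close>, \<open>S\<close> must agree with the way back to \<open>x\<close>, and it cannot
  reach \<open>x\<close> without using \<open>{x, y}\<close>.\<close>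

lemma chain:
  assumes P: "arms T x y P L R" and Q: "arms T x y Q L' R'" and S: "is_path T S" "{x, y} \<notin> S"
    and f: "f \<in> S" "f \<in> path_edges (y # R)" "f \<in> path_edges (y # R')"
    and ns: "nonsplitting P S" "nonsplitting Q S"
  obtains W j where "simple_path T (x # y # W)" "\<not> W \<parallel> R" "\<not> W \<parallel> R'"
    "S = path_edges (drop j (y # W))"
proof -
  obtain A w w' B where A: "y # R = A @ w # w' # B" "f = {w, w'}"
    using f(2) in_path_edges_decomp by metis
  obtain A' u u' B' where A': "y # R' = A' @ u # u' # B'" "f = {u, u'}"
    using f(3) in_path_edges_decomp by metis
  have "simple_path T (rev L @ x # y # R)" "simple_path T (rev L' @ x # y # R')"
    using P Q by (auto simp: arms_def)
  then have xR: "simple_path T (x # y # R)" "simple_path T (x # y # R')"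
    using simple_path_appendD(2) by blast+
  then have yR: "simple_path T (y # R)" "simple_path T (y # R')"
    using simple_path_appendD(2)[of T "[x]"] by auto
  have sA: "simple_path T (A @ [w])" "simple_path T (A @ [w, w'])"
    and sA': "simple_path T (A' @ [u])"
    using yR simple_path_appendD(1)[of T "A @ [w]" "w' # B"]
      simple_path_appendD(1)[of T "A @ [w, w']" B] simple_path_appendD(1)[of T "A' @ [u]" "u' # B'"]
    unfolding A A' by auto
  have hds: "hd (A @ [w]) = y" "hd (A' @ [u]) = y" "hd (A @ [w, w']) = y"
    using A(1) A'(1) by (cases A; cases A'; auto)+
  \<comment> \<open>Both lists run through \<open>f\<close> in the same direction: otherwise
    uniqueness of the path from \<open>y\<close> to \<open>w'\<close> puts \<open>u'\<close> before
    \<open>u\<close>, and the second list would repeat it.\<close>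
  have "u = w \<and> u' = w'"
  proof (rule ccontr)
    assume "\<not> (u = w \<and> u' = w')"
    then have u: "u = w'" "u' = w" using A(2) A'(2) by (auto simp: doubleton_eq_iff)
    then have "A @ [w, w'] = A' @ [u]" using simple_path_unique[OF sA(2) sA'] hds by simp
    then have "u' \<in> set A'" using u by (metis append.assoc append_Cons append_Nil in_set_conv_decomp
          butlast_snoc)
    then show False using yR(2) unfolding A' by (auto simp: simple_path_def)
  qed
  then have A'': "y # R' = A @ w # w' # B'"
    using simple_path_unique[OF sA(1) sA'] hds A' by simp
  \<comment> \<open>From here on arms are taken at \<open>f\<close>; the old left arm turns into the
    tail of the way back.\<close>
  have Pw: "arms T w w' P (rev A @ x # L) B" and Qw: "arms T w w' Q (rev A @ x # L') B'"
    using P Q A A'' by (simp_all add: arms_def)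
  obtain Z W' where Sw: "arms T w w' S Z W'" using arms_exist S(1) f(1) A(2) by metis
  have npZ: "\<not> rev A @ x # L \<parallel> Z" and npB: "\<not> B \<parallel> W'" and npB': "\<not> B' \<parallel> W'"
    using arms_nonsplitting[OF Pw Sw ns(1)] arms_nonsplitting[OF Qw Sw ns(2)] by auto
  \<comment> \<open>The backward arm of \<open>S\<close> either stops before \<open>x\<close> or
    runs through \<open>x\<close>; the second case is excluded next.\<close>
  have "prefix Z (rev A) \<or> prefix (rev A @ [x]) Z"
  proof (cases "prefix (rev A @ x # L) Z")
    case True
    then show ?thesis by (metis append.assoc append_Cons append_Nil append_prefixD)
  next
    case False
    then have "prefix Z (rev A @ x # L)" using npZ by (auto simp: parallel_def)
    then show ?thesis by (auto simp: prefix_append prefix_Cons)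
  qed
  moreover have "\<not> prefix (rev A @ [x]) Z"
  proof
    assume "prefix (rev A @ [x]) Z"
    then obtain Z' where Z': "Z = rev A @ x # Z'" by (auto simp: prefix_def)
    have *: "A @ w # w' # W' = y # tl (A @ w # w' # W')" using A(1) by (cases A) auto
    have "S = path_edges (rev Z' @ x # A @ w # w' # W')" using Sw by (simp add: arms_def Z')
    then have "{x, y} \<in> S" using path_edges_split[of "rev Z'" x y] * by (metis UnCI insertI1)
    then show False using S(2) by simp
  qed
  ultimately obtain Z2 where "rev A = Z @ Z2" by (auto simp: prefix_def)
  then have AZ: "A = rev Z2 @ rev Z" by (metis rev_append rev_rev_ident)
  \<comment> \<open>\<open>tl\<close> removes the leading \<open>y\<close>. It is present also when
    \<open>A\<close> is empty, since then \<open>w = y\<close>.\<close>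
  define W where "W = tl (A @ w # w' # W')"
  have W: "y # W = A @ w # w' # W'" using A(1) unfolding W_def by (cases A) auto
  have "S = path_edges (drop (length Z2) (y # W))"
    using Sw unfolding W by (simp add: AZ arms_def)
  moreover have "simple_path T (x # y # W)"
  proof -
    have "simple_path T ((x # A) @ w # w' # W')"
    proof (rule simple_path_join)
      show "simple_path T ((x # A) @ [w, w'])"
        using xR(1) simple_path_appendD(1)[of T "x # A @ [w, w']" B] unfolding A by simp
      show "simple_path T (w # w' # W')"
        using Sw simple_path_appendD(2)[of T "rev Z"] by (simp add: arms_def)
    qed
    then show ?thesis unfolding W by simp
  qed
  moreover have "\<not> y # W \<parallel> y # R" "\<not> y # W \<parallel> y # R'"
    unfolding W A A'' using npB npB' by (auto simp: parallel_def)
  then have "\<not> W \<parallel> R" "\<not> W \<parallel> R'" by (auto simp: parallel_def)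
  ultimately show ?thesis using that by blast
qed

text \<open>The converse of \<open>arms_nonsplitting\<close>: keeping the longer arm on each side
  gives, by gluing, one path that contains both \<open>P\<close> and \<open>Q\<close>.\<close>

lemma arms_comparable_nonsplitting:
  assumes P: "arms T x y P L R" and Q: "arms T x y Q L' R'" and np: "\<not> L \<parallel> L'" "\<not> R \<parallel> R'"
  shows "nonsplitting P Q"
proof -
  define M where "M = (if prefix L L' then L' else L)"
  define N where "N = (if prefix R R' then R' else R)"
  have M: "prefix L M" "prefix L' M" "M = L \<or> M = L'"
    using np(1) by (auto simp: M_def parallel_def)
  have N: "prefix R N" "prefix R' N" "N = R \<or> N = R'"
    using np(2) by (auto simp: N_def parallel_def)
  have MN: "simple_path T (rev M @ x # y # N)" using M(3) N(3) arms_join P Q by metis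
  then have "arms T x y (path_edges (rev M @ x # y # N)) M N" by (simp add: arms_def)
  from arms_edges[OF this] arms_edges[OF P] arms_edges[OF Q] M(1,2) N(1,2)
  have "P \<union> Q \<subseteq> path_edges (rev M @ x # y # N)"
    using path_edges_mono_prefix[of "x # L" "x # M"] path_edges_mono_prefix[of "x # L'" "x # M"]
      path_edges_mono_prefix[of "y # R" "y # N"] path_edges_mono_prefix[of "y # R'" "y # N"]
    by auto
  moreover have "distinct (rev M @ x # y # N)" using MN by (simp add: simple_path_def)
  ultimately have "split_vertices P Q = {}" using split_vertices_within_path by metis
  then show ?thesis
    using arms_edges[OF P] arms_edges[OF Q] by (auto simp: nonsplitting_def intersecting_def)
qed

text \<open>The variant for a path \<open>S\<close> off the base edge, known only through a word
  \<open>W\<close> that carries it.\<close>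

lemma arms_intersecting_nonsplitting:
  assumes "arms T x y P L R" "simple_path T (x # y # W)" "\<not> R \<parallel> W"
    "S \<subseteq> path_edges (y # W)" "P \<inter> S \<noteq> {}"
  shows "nonsplitting P S"
proof -
  define M where "M = (if prefix R W then W else R)"
  have M: "prefix R M" "prefix W M" "M = R \<or> M = W"
    using assms(3) by (auto simp: M_def parallel_def)
  have "arms T x y (path_edges (x # y # W)) [] W" using assms(2) by (simp add: arms_def)
  then have "simple_path T (rev L @ x # y # M)" using M(3) assms(1) arms_join by metis
  then have "distinct (rev L @ x # y # M)" by (simp add: simple_path_def)
  moreover have "P \<subseteq> path_edges (rev L @ x # y # M)"
    using assms(1) M(1) path_edges_mono_prefix[of "rev L @ x # y # R" "rev L @ x # y # M"]
    by (simp add: arms_def)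
  moreover have "path_edges (y # W) \<subseteq> path_edges (rev L @ x # y # M)"
    using path_edges_mono_prefix[of "y # W" "y # M"] M(2) path_edges_split[of "rev L" x y M] by auto
  ultimately have "split_vertices P S = {}"
    using assms(4) split_vertices_within_path[of "rev L @ x # y # M" P S] by blast
  then show ?thesis using assms(5) by (simp add: nonsplitting_def intersecting_def)
qed

end

text \<open>
  The edges in \<open>F\<close> are those surviving the reduction: \<open>a, b, e, f, c, d\<close> become the edges
  \<open>au, bu, um, mv, vc, vd\<close> of the canonical tree.
\<close>
definition skeleton :: "'a graph \<Rightarrow> 'a set set \<Rightarrow> 'a set set \<Rightarrow> 'a set set \<Rightarrow> 'a set set \<Rightarrow>
    'a set set \<Rightarrow> bool" where
  "skeleton T Q0 Q1 Q2 Q3 Q4 \<longleftrightarrow> (\<exists>s \<alpha> \<beta> m m' p p' t \<gamma> \<delta>.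
    let a = {s, \<alpha>}; b = {s, \<beta>}; e = {m, m'}; f = {p, p'}; c = {t, \<gamma>}; d = {t, \<delta>};
        F = {a, b, e, f, c, d}
    in distinct [a, b, e, f, c, d] \<and> F \<subseteq> edges T \<and>
       joined (edges T - F) s m \<and> joined (edges T - F) m' p \<and> joined (edges T - F) p' t \<and>
       Q0 \<inter> F = {a, e, f} \<and> Q1 \<inter> F = {e, f, c} \<and> Q2 \<inter> F = {b, e} \<and>
       Q3 \<inter> F = {b, e, f, d} \<and> Q4 \<inter> F = {f, d})"

section \<open>Finding the six skeleton edges\<close>

context tree_graph
begin

text \<open>The assumptions on \<open>Q1\<close>, \<open>Q4\<close> and on \<open>Q2\<close>,
  \<open>Q4\<close> do not tell disjoint pairs from split ones. That \<open>Q4\<close> meets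
  \<open>Q1\<close> but misses \<open>Q2\<close> is a result of the proof.\<close>

lemma skeleton_exists:
  assumes P: "is_path T Q4"
    and Q: "arms T x y Q0 L0 R0" "arms T x y Q1 L1 R1" "arms T x y Q2 L2 R2" "arms T x y Q3 L3 R3"
    and ns: "nonsplitting Q0 Q1" "nonsplitting Q1 Q2" "nonsplitting Q2 Q3" "nonsplitting Q3 Q4"
      "nonsplitting Q0 Q4"
    and sp: "\<not> nonsplitting Q1 Q4" "\<not> nonsplitting Q2 Q4"
    and par: "L0 \<parallel> L2" "R1 \<parallel> R3" "L0 \<parallel> L3"
  shows "skeleton T Q0 Q1 Q2 Q3 Q4 \<and> Q2 \<inter> Q4 = {}"
proof -
  have xyE: "{x, y} \<in> E" using arms_in_E Q by blast
  have paths: "is_path T Q0" "is_path T Q3"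
    using arms_is_path[OF Q(1)] arms_is_path[OF Q(4)] by auto
  have L: "\<not> L0 \<parallel> L1" "\<not> L1 \<parallel> L2" "\<not> L2 \<parallel> L3" and R: "\<not> R0 \<parallel> R1" "\<not> R1 \<parallel> R2" "\<not> R2 \<parallel> R3"
    using arms_nonsplitting Q ns by metis+
  have L1: "prefix L1 L0" "prefix L1 L2"
    using comparable_to_parallel[OF par(1)] L(1,2) not_parallel_sym by blast+
  have R2: "prefix R2 R1" "prefix R2 R3"
    using comparable_to_parallel[OF par(2)] R(2,3) not_parallel_sym by blast+
  \<comment> \<open>If \<open>Q4\<close> used the base edge, its left arm would end inside the part
    shared by \<open>L0\<close> and \<open>L3\<close>, and \<open>Q4\<close> would be comparable to
    \<open>Q2\<close> on both sides.\<close>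
  have e4: "{x, y} \<notin> Q4"
  proof
    assume e: "{x, y} \<in> Q4"
    then obtain L4 R4 where Q4: "arms T x y Q4 L4 R4" using arms_exist P by metis
    have np: "\<not> L4 \<parallel> L0" "\<not> L4 \<parallel> L3" "\<not> R3 \<parallel> R4"
      using arms_nonsplitting[OF Q(1) Q4 ns(5)] arms_nonsplitting[OF Q(4) Q4 ns(4)] not_parallel_sym
      by blast+
    have "prefix L4 L3" using comparable_to_parallel[OF par(3) np(1,2)] by blast
    then have LL: "\<not> L4 \<parallel> L2" using prefix_not_parallel L(3) not_parallel_sym by metis
    have RR: "\<not> R2 \<parallel> R4" using prefix_not_parallel R2(2) np(3) by metis
    show False using arms_comparable_nonsplitting[OF Q(3) Q4] LL RR not_parallel_sym sp(2) by blast
  qed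
  have "Q0 \<inter> Q4 \<inter> Q3 \<noteq> {}"
    using helly[OF paths(1) P paths(2) ns(5)] ns(4) arms_edges[OF Q(1)] arms_edges[OF Q(4)]
    by (auto simp: nonsplitting_def intersecting_def)
  then obtain f where f: "f \<in> Q0" "f \<in> Q3" "f \<in> Q4" by blast
  \<comment> \<open>On the side of \<open>x\<close> the word carrying \<open>Q4\<close> would be a
    prefix of \<open>L0\<close> and \<open>L3\<close>, hence of \<open>L2\<close>, and
    \<open>Q4\<close> would lie inside \<open>Q2\<close>.\<close>
  have "\<not> \<Union>Q4 \<subseteq> side x y"
  proof
    assume sub: "\<Union>Q4 \<subseteq> side x y"
    have Q': "arms T y x Q0 R0 L0" "arms T y x Q3 R3 L3" "arms T y x Q2 R2 L2"
      using Q arms_swap by metis+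
    have "f \<in> path_edges (x # L0)" "f \<in> path_edges (x # L3)"
      using arms_edge_on_side Q' f sub by blast+
    from chain[OF Q'(1,2) P _ f(3) this] ns e4 obtain W j where W: "simple_path T (y # x # W)"
      "\<not> W \<parallel> L0" "\<not> W \<parallel> L3" "Q4 = path_edges (drop j (x # W))"
      by (metis insert_commute)
    have sub4: "Q4 \<subseteq> path_edges (x # W)"
      unfolding W(4) using path_edges_append_mono'[of "drop j (x # W)" "take j (x # W)"] by simp
    have W3: "prefix W L0" "prefix W L3" using comparable_to_parallel[OF par(3) W(2,3)] by blast+
    then have "\<not> W \<parallel> L2" using prefix_not_parallel L(3) not_parallel_sym by metis
    \<comment> \<open>If \<open>W\<close> extended \<open>L2\<close>, then \<open>L2\<close> would
      be a prefix of \<open>L0\<close>.\<close>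
    then have "prefix W L2" using W3(1) par(1) not_parallel_cases prefix_order.trans
      by (metis parallel_def)
    then have "Q4 \<subseteq> Q2"
      using sub4 path_edges_mono_prefix[of "x # W" "x # L2"] arms_edges[OF Q(3)] by auto
    moreover have "\<not> L2 \<parallel> W" using \<open>\<not> W \<parallel> L2\<close> not_parallel_sym by blast
    ultimately show False
      using arms_intersecting_nonsplitting[OF Q'(3) W(1) _ sub4] sp(2) f(3) by blast
  qed
  then have sub: "\<Union>Q4 \<subseteq> side y x" using one_side[OF xyE P e4] by blast
  have fR: "f \<in> path_edges (y # R0)" "f \<in> path_edges (y # R3)"
    using arms_edge_on_side Q f sub by blast+
  from chain[OF Q(1,4) P e4 f(3) this ns(5,4)] obtain W j where W: "simple_path T (x # y # W)"
    "\<not> W \<parallel> R0" "\<not> W \<parallel> R3" "Q4 = path_edges (drop j (y # W))" .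
  have sub4: "Q4 \<subseteq> path_edges (y # W)"
    unfolding W(4) using path_edges_append_mono'[of "drop j (y # W)" "take j (y # W)"] by simp
  \<comment> \<open>With comparable words, disjointness is the only way for \<open>Q2\<close> and
    \<open>Q4\<close> not to be nonsplitting.\<close>
  have "\<not> R2 \<parallel> W" using R2(2) W(3) prefix_not_parallel not_parallel_sym by metis
  then have disj: "Q2 \<inter> Q4 = {}"
    using arms_intersecting_nonsplitting[OF Q(3) W(1) _ sub4] sp(2) by blast
  \<comment> \<open>If \<open>R1\<close> and \<open>W\<close> were comparable, \<open>Q4\<close>
    would miss \<open>Q1\<close>, so \<open>W\<close> would extend \<open>R1\<close>; comparability
    of \<open>W\<close> with \<open>R3\<close> would then carry over to \<open>R1\<close>.\<close>
  have RW: "R1 \<parallel> W"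
  proof (rule ccontr)
    assume np: "\<not> R1 \<parallel> W"
    then have "Q1 \<inter> Q4 = {}"
      using arms_intersecting_nonsplitting[OF Q(2) W(1) _ sub4] sp(1) by blast
    then have "\<not> prefix W R1"
      using sub4 path_edges_mono_prefix[of "y # W" "y # R1"] arms_edges[OF Q(2)] f(3) by auto
    then have "prefix R1 W" using np by (auto simp: parallel_def)
    then show False using prefix_not_parallel W(3) par(2) by metis
  qed
  \<comment> \<open>The words \<open>l\<close> and \<open>k\<close> lead to the two branch vertices:
    behind \<open>l\<close> the path \<open>Q3\<close> and the carrier \<open>W\<close> of
    \<open>Q4\<close> part from \<open>Q1\<close>, behind \<open>k\<close> the paths
    \<open>Q2\<close> and \<open>Q3\<close> part from \<open>Q0\<close>.\<close>
  obtain l \<gamma> X1 \<delta> X3 Y where r: "\<gamma> \<noteq> \<delta>" "R1 = l @ \<gamma> # X1" "R3 = l @ \<delta> # X3" "W = l @ \<delta> # Y"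
    using parallel_branch[OF par(2) _ RW] W(3) not_parallel_sym by metis
  obtain k \<alpha> X0 \<beta> X2 X3' where k: "\<alpha> \<noteq> \<beta>" "L0 = k @ \<alpha> # X0" "L2 = k @ \<beta> # X2" "L3 = k @ \<beta> # X3'"
    using parallel_branch[OF par(1) L(3) par(3)] by metis
  have R0: "prefix R0 R1" "prefix R0 W"
    using comparable_to_parallel[OF RW] R(1) W(2) not_parallel_sym by blast+
  have meet: "prefix zs l" if "prefix zs (l @ a # A)" "prefix zs (l @ b # B)" "a \<noteq> b"
    for zs l and a b :: 'a and A B
    using that by (auto simp: prefix_append prefix_Cons)
  \<comment> \<open>\<open>R0\<close> is comparable to both diverging words and thus ends within
    their common part. This confines \<open>f\<close> to the stretch between \<open>y\<close> and
    the branch vertex.\<close>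
  have R0l: "prefix R0 l" using meet R0 r by metis
  have "f \<in> path_edges (y # l)" using fR(1) R0l path_edges_mono_prefix[of "y # R0" "y # l"] by auto
  then obtain A w w' B where A: "y # l = A @ w # w' # B" "f = {w, w'}"
    using in_path_edges_decomp by metis
  define s where "s = last (x # k)"
  define t where "t = last (y # l)"
  have armsW: "arms T x y (path_edges (x # y # W)) [] W" using W(1) by (simp add: arms_def)
  \<comment> \<open>All nine combinations of a left arm with a right word are simple paths. That an
    edge is absent from some \<open>Qi\<close> is proved on a combination containing
    \<open>Qi\<close>.\<close>
  note big = arms_join[OF Q(1) Q(2)] arms_join[OF Q(3) Q(2)] arms_join[OF Q(3) Q(4)]
    arms_join[OF Q(4) Q(4)] arms_join[OF Q(1) armsW] arms_join[OF Q(3) armsW] arms_join[OF Q(1) Q(4)]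
    arms_join[OF Q(4) Q(2)] arms_join[OF Q(4) armsW]
  have dist: "distinct (rev M @ x # y # N)" if "M \<in> {L0, L2, L3}" "N \<in> {R1, R3, W}" for M N
    using that big by (auto simp: simple_path_def)
  have c_notin: "{t, \<gamma>} \<notin> path_edges (rev M @ x # y # N)" if M: "M \<in> {L0, L2, L3}" and N: "N \<in> {R3, W}" for M N
  proof -
    obtain X where X: "N = l @ \<delta> # X" using N r by auto
    show ?thesis
      using branch_edge_not_on_path[of "rev M @ [x]" y l \<delta> X \<gamma> X1] dist[of M R1] dist[of M N] M N r(1,2) X
      unfolding t_def by simp
  qed
  have d_notin: "{t, \<delta>} \<notin> path_edges (rev M @ x # y # R1)" if M: "M \<in> {L0, L2, L3}" for M
    using branch_edge_not_on_path[of "rev M @ [x]" y l \<gamma> X1 \<delta> X3] dist[of M R1] dist[of M R3] M r(1,2,3)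
    unfolding t_def by simp
  \<comment> \<open>The left branch is treated like the right one by reading the combined path
    backwards.\<close>
  have flip: "rev N @ y # x # M = rev (rev M @ x # y # N)" for M N by simp
  have dist': "distinct (rev N @ y # x # M)" if "M \<in> {L0, L2, L3}" "N \<in> {R1, R3, W}" for M N
    using dist[OF that] unfolding flip by (simp only: distinct_rev)
  have pe: "path_edges (rev N @ y # x # M) = path_edges (rev M @ x # y # N)" for M N
    unfolding flip by (simp only: path_edges_rev)
  have a_notin: "{s, \<alpha>} \<notin> path_edges (rev M @ x # y # N)" if M: "M \<in> {L2, L3}" and N: "N \<in> {R1, R3, W}" for M N
  proof -
    obtain X where X: "M = k @ \<beta> # X" using M k by auto
    show ?thesis
      using branch_edge_not_on_path[of "rev N @ [y]" x k \<beta> X \<alpha> X0] dist'[of L0 N] dist'[of M N] M N k(1,2) X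
      unfolding s_def pe[of N M, symmetric] by simp
  qed
  have b_notin: "{s, \<beta>} \<notin> path_edges (rev L0 @ x # y # N)" if N: "N \<in> {R1, R3, W}" for N
    using branch_edge_not_on_path[of "rev N @ [y]" x k \<alpha> X0 \<beta> X2] dist'[of L0 N] dist'[of L2 N] N k(1,2,3)
    unfolding s_def pe[of N L0, symmetric] by simp
  have pe_mono: "path_edges (rev M @ x # y # N) \<subseteq> path_edges (rev M' @ x # y # N')"
    if "prefix M M'" "prefix N N'" for M N M' N'
  proof -
    have "path_edges (rev M @ [x]) = path_edges (x # M)" "path_edges (rev M' @ [x]) = path_edges (x # M')"
      by (metis path_edges_rev rev.simps(2))+
    then show ?thesis unfolding path_edges_split using that path_edges_mono_prefix[of "x # M" "x # M'"]
      path_edges_mono_prefix[of "y # N" "y # N'"] by auto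
  qed
  have Q0s: "Q0 \<subseteq> path_edges (rev L0 @ x # y # R1)" "Q0 \<subseteq> path_edges (rev L0 @ x # y # W)"
    and Q1s: "Q1 \<subseteq> path_edges (rev L0 @ x # y # R1)" "Q1 \<subseteq> path_edges (rev L2 @ x # y # R1)"
    and Q2s: "Q2 \<subseteq> path_edges (rev L2 @ x # y # R1)" "Q2 \<subseteq> path_edges (rev L2 @ x # y # R3)"
    and Q3s: "Q3 \<subseteq> path_edges (rev L3 @ x # y # R3)"
    using Q pe_mono L1 R2 R0 by (auto simp: arms_def)
  have Q4s: "Q4 \<subseteq> path_edges (rev M @ x # y # W)" for M
    using sub4 unfolding path_edges_split by blast
  have ab: "{s, \<alpha>} \<in> Q0" "{s, \<beta>} \<in> Q2" "{s, \<beta>} \<in> Q3"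
  proof -
    have *: "{s, c} \<in> path_edges (x # k @ c # X)" for c X
    proof -
      have "x # k @ c # X = butlast (x # k) @ s # c # X"
        unfolding s_def by (metis append.assoc append_Cons append_Nil append_butlast_last_id list.discI)
      then show ?thesis using path_edges_split[of "butlast (x # k)" s c X]
        by (metis Un_iff insertI1)
    qed
    show "{s, \<alpha>} \<in> Q0" "{s, \<beta>} \<in> Q2" "{s, \<beta>} \<in> Q3"
      using * arms_edges[OF Q(1)] arms_edges[OF Q(3)] arms_edges[OF Q(4)] k by auto
  qed
  have tend: "{t, c} \<in> path_edges (as @ w' # B @ c # X)" for c X as
  proof -
    have "t = last (w' # B)" using A(1) unfolding t_def by simp
    then have "as @ w' # B @ c # X = (as @ butlast (w' # B)) @ t # c # X"
      by (metis append.assoc append_Cons append_Nil append_butlast_last_id list.discI)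
    then show ?thesis using path_edges_split[of "as @ butlast (w' # B)" t c X]
      by (metis Un_iff insertI1)
  qed
  have yl: "y # R1 = (A @ [w]) @ w' # B @ \<gamma> # X1" "y # R3 = (A @ [w]) @ w' # B @ \<delta> # X3"
    "y # W = (A @ [w]) @ w' # B @ \<delta> # Y"
    using A(1) r by (metis append.assoc append_Cons append_Nil)+
  have cd: "{t, \<gamma>} \<in> Q1" "{t, \<delta>} \<in> Q3"
    using tend[of \<gamma> "A @ [w]" X1] tend[of \<delta> "A @ [w]" X3] arms_edges[OF Q(2)] arms_edges[OF Q(4)]
    unfolding yl by auto
  \<comment> \<open>\<open>Q4\<close> contains \<open>f\<close>, so it cannot start beyond
    \<open>w\<close>; being a tail of \<open>y # W\<close>, it then continues through the branch
    vertex to \<open>\<delta>\<close>.\<close>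
  have "j \<le> length A"
  proof (rule ccontr)
    assume "\<not> j \<le> length A"
    then have "set (drop j (y # W)) \<subseteq> set (w' # B @ \<delta> # Y)"
      unfolding yl by (auto simp: drop_Cons' dest: in_set_dropD split: if_splits)
    moreover have "w \<in> set (drop j (y # W))"
      using f(3) path_edges_subset_set[of f] unfolding W(4) A(2) by blast
    moreover have "w \<notin> set (w' # B @ \<delta> # Y)"
      using dist[of L0 W] unfolding yl by auto
    ultimately show False by blast
  qed
  then have "drop j (y # W) = (drop j A @ [w]) @ w' # B @ \<delta> # Y" unfolding yl by simp
  then have d4: "{t, \<delta>} \<in> Q4" using tend[of \<delta> "drop j A @ [w]" Y] unfolding W(4) by simp
  have f1: "f \<in> Q1" using arms_edges[OF Q(2)] path_edges_split[of A w w' "B @ \<gamma> # X1"]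
    unfolding A(2) yl by simp
  have e: "{x, y} \<in> Q0" "{x, y} \<in> Q1" "{x, y} \<in> Q2" "{x, y} \<in> Q3"
    using arms_edges[OF Q(1)] arms_edges[OF Q(2)] arms_edges[OF Q(3)] arms_edges[OF Q(4)] by auto
  have f2: "f \<notin> Q2" using disj f(3) by blast
  have "{s, \<alpha>} \<notin> Q1" "{s, \<alpha>} \<notin> Q2" "{s, \<alpha>} \<notin> Q3" "{s, \<alpha>} \<notin> Q4"
    using a_notin[of L2 R1] a_notin[of L3 R3] a_notin[of L2 W] Q1s Q2s Q3s Q4s by blast+
  note na = this
  have "{s, \<beta>} \<notin> Q0" "{s, \<beta>} \<notin> Q1" "{s, \<beta>} \<notin> Q4"
    using b_notin[of R1] b_notin[of W] Q0s Q1s Q4s by blast+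
  note nb = this
  have "{t, \<gamma>} \<notin> Q0" "{t, \<gamma>} \<notin> Q2" "{t, \<gamma>} \<notin> Q3" "{t, \<gamma>} \<notin> Q4"
    using c_notin[of L0 W] c_notin[of L2 R3] c_notin[of L3 R3] Q0s Q2s Q3s Q4s[of L0] by blast+
  note nc = this
  have "{t, \<delta>} \<notin> Q0" "{t, \<delta>} \<notin> Q1" "{t, \<delta>} \<notin> Q2"
    using d_notin[of L0] d_notin[of L2] Q0s Q1s Q2s by blast+
  note nd = this
  let ?F = "{{s, \<alpha>}, {s, \<beta>}, {x, y}, {w, w'}, {t, \<gamma>}, {t, \<delta>}}"
  have ff: "{w, w'} \<in> Q0" "{w, w'} \<in> Q1" "{w, w'} \<notin> Q2" "{w, w'} \<in> Q3" "{w, w'} \<in> Q4"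
    using f f1 f2 A(2) by auto
  have FE: "?F \<subseteq> E"
    using ab cd e ff Q by (auto simp: arms_def simple_path_def)
  have d1: "distinct (rev k @ x # y # l @ [\<gamma>])" "distinct (rev k @ x # y # l @ [\<delta>])"
     "distinct (\<alpha> # rev k @ x # y # l)" "distinct (\<beta> # rev k @ x # y # l)"
    using dist[of L0 R1] dist[of L0 R3] dist[of L2 R1] by (auto simp: k r)
  have ww: "w \<in> set (y # l)" "w' \<in> set (y # l)" "w \<notin> set (w' # B)" "w' \<notin> set (A @ [w])"
     "set (A @ [w]) \<subseteq> set (y # l)" "set (w' # B) \<subseteq> set (y # l)"
  proof -
    have "distinct (y # l)" using d1(3) by auto
    then show "w \<in> set (y # l)" "w' \<in> set (y # l)" "w \<notin> set (w' # B)" "w' \<notin> set (A @ [w])"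
     "set (A @ [w]) \<subseteq> set (y # l)" "set (w' # B) \<subseteq> set (y # l)"
      unfolding A(1) by auto
  qed
  \<comment> \<open>Each of the three connecting segments avoids \<open>?F\<close> because every
    edge of \<open>?F\<close> has an end outside the segment.\<close>
  have sep: "path_edges zs \<subseteq> E - ?F" if "path_edges zs \<subseteq> E" "\<And>g. g \<in> ?F \<Longrightarrow> \<not> g \<subseteq> set zs" for zs
    using that path_edges_subset_set[of _ zs] by blast
  have "path_edges (x # k) \<subseteq> E - ?F"
  proof (rule sep)
    show "path_edges (x # k) \<subseteq> E"
      using arms_edges[OF Q(1)] path_edges_mono_prefix[of "x # k" "x # L0"] Q(1) k
      by (auto simp: arms_def simple_path_def)
    show "\<not> g \<subseteq> set (x # k)" if "g \<in> ?F" for g using that d1 ww by auto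
  qed
  then have j1: "joined (E - ?F) s x" by (rule joined_on_path) (auto simp: s_def)
  have E1: "path_edges (y # R1) \<subseteq> E" using arms_edges[OF Q(2)] Q(2) by (auto simp: arms_def simple_path_def)
  have "path_edges (A @ [w]) \<subseteq> E - ?F"
  proof (rule sep)
    show "path_edges (A @ [w]) \<subseteq> E"
      using E1 path_edges_append_mono[of "A @ [w]" "w' # B @ \<gamma> # X1"] unfolding yl by blast
    show "\<not> g \<subseteq> set (A @ [w])" if "g \<in> ?F" for g using that d1 ww by auto
  qed
  then have j2: "joined (E - ?F) y w"
    by (rule joined_on_path) (use A(1) in \<open>cases A; auto\<close>)+
  have "path_edges (w' # B) \<subseteq> E - ?F"
  proof (rule sep)
    show "path_edges (w' # B) \<subseteq> E"
      using E1 path_edges_append_mono'[of "w' # B @ \<gamma> # X1" "A @ [w]"]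
         path_edges_append_mono[of "w' # B" "\<gamma> # X1"] unfolding yl by auto
    show "\<not> g \<subseteq> set (w' # B)" if "g \<in> ?F" for g using that d1 ww by auto
  qed
  then have j3: "joined (E - ?F) w' t"
    by (rule joined_on_path) (use A(1) in \<open>auto simp: t_def\<close>)
  have dd: "distinct [{s, \<alpha>}, {s, \<beta>}, {x, y}, {w, w'}, {t, \<gamma>}, {t, \<delta>}]"
    using ab cd e ff na nb nc nd e4 d4 by (simp, metis)
  have "skeleton T Q0 Q1 Q2 Q3 Q4"
    unfolding skeleton_def Let_def
  proof (intro exI conjI)
    show "distinct [{s, \<alpha>}, {s, \<beta>}, {x, y}, {w, w'}, {t, \<gamma>}, {t, \<delta>}]" by (fact dd)
    show "?F \<subseteq> E" by (fact FE)
    show "joined (E - ?F) s x" by (fact j1)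
    show "joined (E - ?F) y w" by (fact j2)
    show "joined (E - ?F) w' t" by (fact j3)
  qed (use ab cd e ff na nb nc nd e4 d4 in auto)
  then show ?thesis using disj by blast
qed

end

section \<open>Minifying operations\<close>

text \<open>The bijection is injective only on host vertices, so its inverse recovers edges only if
  they consist of such vertices; hence the two side conditions.\<close>

lemma rep_isomorphic_sym:
  assumes "rep_isomorphic V R R'" "\<forall>e\<in>edges (host R). e \<subseteq> verts (host R)"
    "\<forall>v\<in>V. rpath R v \<subseteq> edges (host R)"
  shows "rep_isomorphic V R' R"
proof -
  obtain f where f: "bij_betw f (verts (host R)) (verts (host R'))"
    "edges (host R') = (`) f ` edges (host R)" "\<forall>v\<in>V. rpath R' v = (`) f ` rpath R v"
    using assms(1) by (auto simp: rep_isomorphic_def)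
  define h where "h = inv_into (verts (host R)) f"
  have inj: "inj_on f (verts (host R))" using f(1) by (simp add: bij_betw_def)
  have hf: "h ` f ` e = e" if "e \<in> edges (host R)" for e
    using that assms(2) inv_into_image_cancel[OF inj] by (simp add: h_def)
  have A: "(`) h ` (`) f ` A = A" if "A \<subseteq> edges (host R)" for A
  proof -
    have "(`) h ` (`) f ` A = (\<lambda>e. h ` f ` e) ` A" by (rule image_image)
    also have "\<dots> = (\<lambda>e. e) ` A" by (rule image_cong[OF refl], rule hf) (use that in blast)
    finally show ?thesis by simp
  qed
  have "bij_betw h (verts (host R')) (verts (host R))"
    unfolding h_def using bij_betw_inv_into[OF f(1)] .
  moreover have "edges (host R) = (`) h ` edges (host R')" using A[of "edges (host R)"] f(2) by simp
  moreover have "\<forall>v\<in>V. rpath R v = (`) h ` rpath R' v" using A f(3) assms(3) by simp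
  ultimately show ?thesis unfolding rep_isomorphic_def by blast
qed

lemma rep_isomorphic_trans:
  assumes "rep_isomorphic V R R'" "rep_isomorphic V R' R''"
  shows "rep_isomorphic V R R''"
proof -
  obtain f where f: "bij_betw f (verts (host R)) (verts (host R'))"
    "edges (host R') = (`) f ` edges (host R)" "\<forall>v\<in>V. rpath R' v = (`) f ` rpath R v"
    using assms(1) by (auto simp: rep_isomorphic_def)
  obtain g where g: "bij_betw g (verts (host R')) (verts (host R''))"
    "edges (host R'') = (`) g ` edges (host R')" "\<forall>v\<in>V. rpath R'' v = (`) g ` rpath R' v"
    using assms(2) by (auto simp: rep_isomorphic_def)
  have gf: "(`) g ` (`) f ` A = (`) (g \<circ> f) ` A" for A
    by (simp add: image_image comp_def)
  have "bij_betw (g \<circ> f) (verts (host R)) (verts (host R''))" by (rule bij_betw_trans[OF f(1) g(1)])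
  moreover have "edges (host R'') = (`) (g \<circ> f) ` edges (host R)" using f(2) g(2) gf by simp
  moreover have "\<forall>v\<in>V. rpath R'' v = (`) (g \<circ> f) ` rpath R v" using f(3) g(3) gf by simp
  ultimately show ?thesis unfolding rep_isomorphic_def by blast
qed

text \<open>An edge whose image under \<open>g\<close> is a singleton is a collapsed one. If
  collapsed edges hold each fibre of \<open>g\<close> together, contracting them one at a time
  realises \<open>g\<close>. Both directions of the isomorphism are recorded: one carries
  \<open>represents\<close> over to the result, the other is composed with the isomorphism given by
  minimality.\<close>

lemma contract_fibres:
  fixes R :: "('v, 't) representation" and R0 :: "('v, 's) representation" and g :: "'t \<Rightarrow> 's"
  assumes "finite (verts (host R))"
    and "\<forall>e\<in>edges (host R). \<exists>x y. e = {x, y} \<and> x \<noteq> y \<and> x \<in> verts (host R) \<and> y \<in> verts (host R)"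
    and "\<forall>v\<in>V. rpath R v \<subseteq> edges (host R)"
    and "\<forall>x\<in>verts (host R). \<forall>y\<in>verts (host R). g x = g y \<longrightarrow>
           joined {e \<in> edges (host R). card (g ` e) = 1} x y"
    and "g ` verts (host R) = verts (host R0)"
    and "(`) g ` {e \<in> edges (host R). card (g ` e) \<noteq> 1} = edges (host R0)"
    and "\<forall>v\<in>V. (`) g ` {e \<in> rpath R v. card (g ` e) \<noteq> 1} = rpath R0 v"
  shows "\<exists>R'. (minify V)\<^sup>*\<^sup>* R R' \<and> rep_isomorphic V R' R0 \<and> rep_isomorphic V R0 R'"
  using assms
proof (induction "card (verts (host R))" arbitrary: R rule: less_induct)
  case less
  note fin = less.prems(1) and ed = less.prems(2) and rp = less.prems(3) and fib = less.prems(4)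
    and gv = less.prems(5) and ge = less.prems(6) and gr = less.prems(7)
  show ?case
  proof (cases "\<exists>e\<in>edges (host R). card (g ` e) = 1")
    case False
    then have "{e \<in> edges (host R). card (g ` e) = 1} = {}" by blast
    then have "x = y" if "x \<in> verts (host R)" "y \<in> verts (host R)" "g x = g y" for x y
      using fib[rule_format, OF that] joined_empty[of x y] by metis
    then have "inj_on g (verts (host R))" by (rule inj_onI)
    then have "bij_betw g (verts (host R)) (verts (host R0))" using gv by (simp add: bij_betw_def)
    moreover have "{e \<in> edges (host R). card (g ` e) \<noteq> 1} = edges (host R)"
      using False by blast
    moreover have "{e \<in> rpath R v. card (g ` e) \<noteq> 1} = rpath R v" if "v \<in> V" for v
      using False rp that by blast
    ultimately have iso: "rep_isomorphic V R R0"
      unfolding rep_isomorphic_def using ge gr by (intro exI[of _ g]) auto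
    moreover have "rep_isomorphic V R0 R"
      by (rule rep_isomorphic_sym[OF iso _ rp]) (use ed in fastforce)
    ultimately show ?thesis by blast
  next
    case True
    then obtain x y where xy: "{x, y} \<in> edges (host R)" "x \<noteq> y" "x \<in> verts (host R)"
      "y \<in> verts (host R)" "card (g ` {x, y}) = 1" using ed by metis
    then have gxy: "g x = g y" by (cases "g x = g y") auto
    define f where "f = contract_map x y"
    define R1 where "R1 = contract_rep x y R"
    \<comment> \<open>The contraction merges two vertices of one fibre, so \<open>g\<close> factors
      through \<open>f\<close> and serves unchanged for the smaller representation.\<close>
    have gf: "g (f z) = g z" for z by (simp add: f_def contract_map_def gxy)
    then have gfe: "g ` f ` e = g ` e" for e by (auto simp: image_image)
    have R1: "verts (host R1) = f ` verts (host R)"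
      "edges (host R1) = (`) f ` (edges (host R) - {{x, y}})"
      "rpath R1 v = (`) f ` (rpath R v - {{x, y}})" for v
      by (simp_all add: R1_def contract_rep_def contract_edges_def f_def)
    have fid: "f (f z) = f z" for z using xy(2) by (simp add: f_def contract_map_def)
    have im: "(`) g ` {e \<in> (`) f ` (A - {{x, y}}). card (g ` e) \<noteq> 1} = (`) g ` {e \<in> A. card (g ` e) \<noteq> 1}"
      for A
    proof -
      have "{e \<in> (`) f ` (A - {{x, y}}). card (g ` e) \<noteq> 1} = (`) f ` {e \<in> A. card (g ` e) \<noteq> 1}"
        using xy(5) by (auto simp: gfe)
      then show ?thesis by (simp add: image_image gf)
    qed
    have "\<exists>R'. (minify V)\<^sup>*\<^sup>* R1 R' \<and> rep_isomorphic V R' R0 \<and> rep_isomorphic V R0 R'"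
    proof (rule less.hyps)
      have "verts (host R1) \<subseteq> verts (host R) - {y}"
        using xy(2,3) by (auto simp: R1 f_def contract_map_def)
      then have "verts (host R1) \<subset> verts (host R)" using xy(4) by blast
      then show "card (verts (host R1)) < card (verts (host R))" using fin psubset_card_mono by blast
      show "finite (verts (host R1))" using fin by (simp add: R1)
      show "\<forall>e\<in>edges (host R1). \<exists>u v. e = {u, v} \<and> u \<noteq> v \<and> u \<in> verts (host R1) \<and> v \<in> verts (host R1)"
      proof
        fix e assume "e \<in> edges (host R1)"
        then obtain e' where e': "e = f ` e'" "e' \<in> edges (host R)" "e' \<noteq> {x, y}" by (auto simp: R1)
        then obtain u v where uv: "e' = {u, v}" "u \<noteq> v" "u \<in> verts (host R)" "v \<in> verts (host R)"
          using ed by blast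
        \<comment> \<open>Only \<open>{x, y}\<close> itself could become a loop.\<close>
        then have "f u \<noteq> f v" using e'(3) by (auto simp: f_def contract_map_def split: if_splits)
        then show "\<exists>u v. e = {u, v} \<and> u \<noteq> v \<and> u \<in> verts (host R1) \<and> v \<in> verts (host R1)"
          using uv e'(1) by (auto simp: R1)
      qed
      show "\<forall>v\<in>V. rpath R1 v \<subseteq> edges (host R1)" using rp by (auto simp: R1)
      show "\<forall>u\<in>verts (host R1). \<forall>v\<in>verts (host R1). g u = g v \<longrightarrow>
          joined {e \<in> edges (host R1). card (g ` e) = 1} u v"
      proof (intro ballI impI)
        fix u v assume u: "u \<in> verts (host R1)" and v: "v \<in> verts (host R1)" and "g u = g v"
        have fu: "f u = u" "f v = v" using u v fid by (auto simp: R1)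
        have "u \<in> verts (host R)" "v \<in> verts (host R)"
          using u v xy(3) by (auto simp: R1 f_def contract_map_def)
        then have "joined {e \<in> edges (host R). card (g ` e) = 1} u v"
          using fib \<open>g u = g v\<close> by blast
        \<comment> \<open>The walk is carried along by \<open>f\<close>; steps over
          \<open>{x, y}\<close> disappear.\<close>
        then have "joined {e \<in> edges (host R1). card (g ` e) = 1} (f u) (f v)"
        proof (induction rule: joined_induct)
          case (step b c)
          show ?case
          proof (cases "{b, c} = {x, y}")
            case True
            then have "f b = f c" by (auto simp: f_def contract_map_def doubleton_eq_iff)
            then show ?thesis using step by simp
          next
            case False
            then have "{b, c} \<in> edges (host R) - {{x, y}}" using step(2) by blast
            then have "f ` {b, c} \<in> edges (host R1)" unfolding R1 by (rule imageI)
            moreover have "card (g ` f ` {b, c}) = 1" using step(2) unfolding gfe by simp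
            ultimately have "{f b, f c} \<in> {e \<in> edges (host R1). card (g ` e) = 1}" by auto
            then show ?thesis by (rule joined_step[OF step(3)])
          qed
        qed simp
        then show "joined {e \<in> edges (host R1). card (g ` e) = 1} u v" by (simp add: fu)
      qed
      show "g ` verts (host R1) = verts (host R0)" using gv by (simp add: R1 gfe)
      show "(`) g ` {e \<in> edges (host R1). card (g ` e) \<noteq> 1} = edges (host R0)"
        using ge by (simp only: R1 im)
      show "\<forall>v\<in>V. (`) g ` {e \<in> rpath R1 v. card (g ` e) \<noteq> 1} = rpath R0 v"
        using gr by (simp only: R1 im)
    qed
    moreover have "minify V R R1" unfolding R1_def by (rule minify.contract) (use xy in auto)
    ultimately show ?thesis by (meson converse_rtranclp_into_rtranclp)
  qed
qed

text \<open>
  Normal form of an iterated minification: the edges in \<open>D\<close> are contracted by \<open>f\<close>, and the path of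
  \<open>v\<close> is cut down to the image of \<open>S v\<close>.
\<close>
lemma minify_normal_form:
  assumes "(minify V)\<^sup>*\<^sup>* R R'"
    and ed: "\<forall>e\<in>edges (host R). \<exists>x y. e = {x, y} \<and> x \<in> verts (host R) \<and> y \<in> verts (host R)"
    and rp: "\<forall>v\<in>V. rpath R v \<subseteq> edges (host R)"
  shows "\<exists>f D S. verts (host R') = f ` verts (host R) \<and> D \<subseteq> edges (host R) \<and>
    edges (host R') = (`) f ` (edges (host R) - D) \<and>
    (\<forall>v\<in>V. S v \<subseteq> rpath R v - D \<and> rpath R' v = (`) f ` S v) \<and>
    (\<forall>x\<in>verts (host R). \<forall>y\<in>verts (host R). f x = f y \<longrightarrow> joined D x y)"
  using assms(1)
proof (induction rule: rtranclp_induct)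
  case base
  show ?case by (intro exI[of _ id] exI[of _ "{}"] exI[of _ "rpath R"]) (simp add: image_def)
next
  case (step R1 R2)
  then obtain f D S where f: "verts (host R1) = f ` verts (host R)" "D \<subseteq> edges (host R)"
    "edges (host R1) = (`) f ` (edges (host R) - D)"
    "\<And>v. v \<in> V \<Longrightarrow> S v \<subseteq> rpath R v - D" "\<And>v. v \<in> V \<Longrightarrow> rpath R1 v = (`) f ` S v"
    "\<And>x y. x \<in> verts (host R) \<Longrightarrow> y \<in> verts (host R) \<Longrightarrow> f x = f y \<Longrightarrow> joined D x y"
    by metis
  from step(2) show ?case
  proof cases
    case (contract x y)
    define h where "h = contract_map x y"
    \<comment> \<open>All edges lying over \<open>{x, y}\<close> are added, since injectivity of
      \<open>f\<close> on edges is not part of the normal form.\<close>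
    define D' where "D' = D \<union> {e \<in> edges (host R). f ` e = {x, y}}"
    obtain e0 where e0: "e0 \<in> edges (host R) - D" "f ` e0 = {x, y}"
      using contract(2) f(3) by auto
    then obtain a b where "e0 = {a, b}" "a \<in> verts (host R)" "b \<in> verts (host R)" using ed by blast
    then have "\<exists>a b. e0 = {a, b} \<and> f a = x \<and> f b = y \<and> a \<in> verts (host R) \<and> b \<in> verts (host R)"
      using e0(2) by (auto simp: doubleton_eq_iff insert_commute)
    then obtain a b where ab: "e0 = {a, b}" "f a = x" "f b = y" "a \<in> verts (host R)" "b \<in> verts (host R)"
      by blast
    have abD: "{a, b} \<in> D'" "{b, a} \<in> D'" using e0 ab by (auto simp: D'_def insert_commute)
    have D: "D \<subseteq> D'" by (auto simp: D'_def)
    \<comment> \<open>Vertices identified by \<open>h \<circ> f\<close> have the same image under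
      \<open>f\<close> or lie in the fibres over \<open>x\<close> and \<open>y\<close>, which the
      edge \<open>{a, b}\<close> now links.\<close>
    have ker: "joined D' u v" if u: "u \<in> verts (host R)" and v: "v \<in> verts (host R)"
      and eq: "h (f u) = h (f v)" for u v
    proof -
      have J: "joined D' p q" if "p \<in> verts (host R)" "q \<in> verts (host R)" "f p = f q" for p q
        using joined_mono[OF f(6) D] that by blast
      have ab': "joined D' a b" "joined D' b a" using abD joined_step[of D' _ _] joined_refl by metis+
      have "f u = f v \<or> f u = x \<and> f v = y \<or> f u = y \<and> f v = x"
        using eq by (auto simp: h_def contract_map_def split: if_splits)
      then show ?thesis using J[of u v] J[of u a] J[of u b] J[of a v] J[of b v] ab' ab u v
        joined_trans by metis
    qed
    have comp: "(`) h ` ((`) f ` A - {{x, y}}) = (`) (h \<circ> f) ` (A - {e. f ` e = {x, y}})" for A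
    proof -
      have "(`) f ` A - {{x, y}} = (`) f ` (A - {e. f ` e = {x, y}})" by auto
      then show ?thesis by (simp add: image_comp comp_def image_image)
    qed
    have "edges (host R) - D - {e. f ` e = {x, y}} = edges (host R) - D'" by (auto simp: D'_def)
    then have "edges (host R2) = (`) (h \<circ> f) ` (edges (host R) - D')"
      using comp[of "edges (host R) - D"] f(3) contract(1)
      by (simp add: contract_rep_def contract_edges_def h_def)
    moreover have "verts (host R2) = (h \<circ> f) ` verts (host R)"
      using f(1) contract(1) by (simp add: contract_rep_def h_def image_comp)
    moreover have "S v - D' \<subseteq> rpath R v - D' \<and> rpath R2 v = (`) (h \<circ> f) ` (S v - D')" if v: "v \<in> V" for v
    proof -
      have "S v - {e. f ` e = {x, y}} = S v - D'"
        using f(4)[OF v] rp v by (auto simp: D'_def)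
      then have "rpath R2 v = (`) (h \<circ> f) ` (S v - D')"
        using comp[of "S v"] f(5)[OF v] contract(1)
        by (simp add: contract_rep_def contract_edges_def h_def)
      then show ?thesis using f(4)[OF v] by blast
    qed
    moreover have "D' \<subseteq> edges (host R)" using f(2) by (auto simp: D'_def)
    ultimately show ?thesis using ker
      by (intro exI[of _ "h \<circ> f"] exI[of _ D'] exI[of _ "\<lambda>v. S v - D'"]) auto
  next
    case (remove_end w x y xs)
    define S' where "S' = S(w := S w - {e. f ` e = {x, y}})"
    have "(`) f ` S w - {{x, y}} = (`) f ` (S w - {e. f ` e = {x, y}})" by auto
    note w = this
    have "S' v \<subseteq> rpath R v - D" "rpath R2 v = (`) f ` S' v" if v: "v \<in> V" for v
    proof -
      show "S' v \<subseteq> rpath R v - D" using f(4)[OF v] by (auto simp: S'_def)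
      show "rpath R2 v = (`) f ` S' v"
        unfolding remove_end(1) S'_def using w f(5)[OF v] by (cases "v = w") simp_all
    qed
    then show ?thesis using f(1,2,3,6) remove_end(1)
      by (intro exI[of _ f] exI[of _ D] exI[of _ S']) auto
  qed
qed

section \<open>Collapsing a tree with a skeleton onto the canonical tree\<close>

context tree_graph
begin

text \<open>Skeleton edges are bridges. The six cuts together tell in which of the seven components
  of the tree without \<open>F\<close> a vertex lies, and \<open>g\<close> names that
  component.\<close>

lemma skeleton_collapse_map:
  assumes F: "F = {{s, \<alpha>}, {s, \<beta>}, {m, m'}, {p, p'}, {t, \<gamma>}, {t, \<delta>}}"
    and dist: "distinct [{s, \<alpha>}, {s, \<beta>}, {m, m'}, {p, p'}, {t, \<gamma>}, {t, \<delta>}]"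
    and FE: "F \<subseteq> E"
    and j: "joined (E - F) s m" "joined (E - F) m' p" "joined (E - F) p' t"
  obtains g where "g s = Nu" "g \<alpha> = Na" "g \<beta> = Nb" "g m = Nu" "g m' = Nm" "g p = Nm" "g p' = Nv"
    "g t = Nv" "g \<gamma> = Nc" "g \<delta> = Nd"
    "\<And>u v. {u, v} \<in> E - F \<Longrightarrow> g u = g v"
    "\<And>u v. u \<in> verts T \<Longrightarrow> v \<in> verts T \<Longrightarrow> g u = g v \<Longrightarrow> joined (E - F) u v"
proof -
  have inE: "{s, \<alpha>} \<in> E" "{s, \<beta>} \<in> E" "{m, m'} \<in> E" "{p, p'} \<in> E" "{t, \<gamma>} \<in> E" "{t, \<delta>} \<in> E"
    using FE F by auto
  \<comment> \<open>The cut is oriented: \<open>X\<close> contains \<open>y\<close> and not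
    \<open>x\<close>. Below, \<open>y\<close> is always the end farther from
    \<open>s\<close>.\<close>
  define is_cut where "is_cut X x y \<longleftrightarrow> y \<in> X \<and> x \<notin> X \<and>
      (\<forall>u v. {u, v} \<in> E \<longrightarrow> {u, v} \<noteq> {x, y} \<longrightarrow> (u \<in> X \<longleftrightarrow> v \<in> X))" for X x y
  have cutE: "\<exists>X. is_cut X x y" if "{x, y} \<in> E" for x y
    using cut[OF that] unfolding is_cut_def by metis
  have cutF: "u \<in> X \<longleftrightarrow> v \<in> X" if "is_cut X x y" "{x, y} \<in> F" "joined (E - F) u v" for X x y u v
  proof (rule joined_cut[OF that(3)])
    fix u v assume uv: "{u, v} \<in> E - F"
    then have "{u, v} \<noteq> {x, y}" using that(2) by auto
    then show "u \<in> X \<longleftrightarrow> v \<in> X" using that(1) uv unfolding is_cut_def by blast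
  qed
  obtain A where A: "is_cut A s \<alpha>" using cutE[OF inE(1)] ..
  obtain B where B: "is_cut B s \<beta>" using cutE[OF inE(2)] ..
  obtain M where M: "is_cut M m m'" using cutE[OF inE(3)] ..
  obtain P where P: "is_cut P p p'" using cutE[OF inE(4)] ..
  obtain C where C: "is_cut C t \<gamma>" using cutE[OF inE(5)] ..
  obtain D where D: "is_cut D t \<delta>" using cutE[OF inE(6)] ..
  note cuts = A B M P C D
  have inF: "{s, \<alpha>} \<in> F" "{s, \<beta>} \<in> F" "{m, m'} \<in> F" "{p, p'} \<in> F" "{t, \<gamma>} \<in> F" "{t, \<delta>} \<in> F"
    using F by auto
  have step: "u \<in> X \<longleftrightarrow> v \<in> X" if "is_cut X x y" "{u, v} \<in> E" "{u, v} \<noteq> {x, y}" for X x y u v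
    using that by (auto simp: is_cut_def)
  have ends: "y \<in> X" "x \<notin> X" if "is_cut X x y" for X x y
    using that by (auto simp: is_cut_def)
  \<comment> \<open>The thirty ordered inequalities are addressed by position, five for each edge on
    the left-hand side.\<close>
  have neq_if: "a \<noteq> b" "a \<noteq> c" "a \<noteq> d" "a \<noteq> e" "a \<noteq> f" "b \<noteq> a" "b \<noteq> c" "b \<noteq> d" "b \<noteq> e" "b \<noteq> f"
    "c \<noteq> a" "c \<noteq> b" "c \<noteq> d" "c \<noteq> e" "c \<noteq> f" "d \<noteq> a" "d \<noteq> b" "d \<noteq> c" "d \<noteq> e" "d \<noteq> f"
    "e \<noteq> a" "e \<noteq> b" "e \<noteq> c" "e \<noteq> d" "e \<noteq> f" "f \<noteq> a" "f \<noteq> b" "f \<noteq> c" "f \<noteq> d" "f \<noteq> e"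
    if "distinct [a, b, c, d, e, f]" for a b c d e f :: "'a set"
    using that by auto
  note neq = neq_if[OF dist]
  \<comment> \<open>\<open>\<gamma>\<close> and \<open>\<delta>\<close> lie in \<open>P\<close> and
    \<open>M\<close>, and \<open>p'\<close> lies in \<open>M\<close>, so the innermost sets have to
    be tested first.\<close>
  define g where "g z = (if z \<in> A then Na else if z \<in> B then Nb else if z \<in> C then Nc
    else if z \<in> D then Nd else if z \<in> P then Nv else if z \<in> M then Nm else Nu)" for z
  \<comment> \<open>Membership in a cut set is propagated from the ends of the cut edge across the
    other five skeleton edges and the three links.\<close>
  have sA: "s \<notin> A" "\<beta> \<notin> A" "m \<notin> A" "m' \<notin> A" "p \<notin> A" "p' \<notin> A" "t \<notin> A" "\<gamma> \<notin> A" "\<delta> \<notin> A"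
    using ends[OF cuts(1)] cutF[OF cuts(1) inF(1) j(1)] cutF[OF cuts(1) inF(1) j(2)] cutF[OF cuts(1) inF(1) j(3)]
      step[OF cuts(1) inE(2) neq(6)] step[OF cuts(1) inE(3) neq(11)]
      step[OF cuts(1) inE(4) neq(16)] step[OF cuts(1) inE(5) neq(21)] step[OF cuts(1) inE(6) neq(26)]
    by blast+
  have sB: "s \<notin> B" "\<alpha> \<notin> B" "m \<notin> B" "m' \<notin> B" "p \<notin> B" "p' \<notin> B" "t \<notin> B" "\<gamma> \<notin> B" "\<delta> \<notin> B"
    using ends[OF cuts(2)] cutF[OF cuts(2) inF(2) j(1)] cutF[OF cuts(2) inF(2) j(2)] cutF[OF cuts(2) inF(2) j(3)]
      step[OF cuts(2) inE(1) neq(1)] step[OF cuts(2) inE(3) neq(12)]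
      step[OF cuts(2) inE(4) neq(17)] step[OF cuts(2) inE(5) neq(22)] step[OF cuts(2) inE(6) neq(27)]
    by blast+
  have sM: "s \<notin> M" "\<alpha> \<notin> M" "\<beta> \<notin> M" "m \<notin> M" "m' \<in> M" "p \<in> M" "p' \<in> M" "t \<in> M" "\<gamma> \<in> M" "\<delta> \<in> M"
    using ends[OF cuts(3)] cutF[OF cuts(3) inF(3) j(1)] cutF[OF cuts(3) inF(3) j(2)] cutF[OF cuts(3) inF(3) j(3)]
      step[OF cuts(3) inE(1) neq(2)] step[OF cuts(3) inE(2) neq(7)]
      step[OF cuts(3) inE(4) neq(18)] step[OF cuts(3) inE(5) neq(23)] step[OF cuts(3) inE(6) neq(28)]
    by blast+
  have sP: "s \<notin> P" "\<alpha> \<notin> P" "\<beta> \<notin> P" "m \<notin> P" "m' \<notin> P" "p \<notin> P" "p' \<in> P" "t \<in> P" "\<gamma> \<in> P" "\<delta> \<in> P"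
    using ends[OF cuts(4)] cutF[OF cuts(4) inF(4) j(1)] cutF[OF cuts(4) inF(4) j(2)] cutF[OF cuts(4) inF(4) j(3)]
      step[OF cuts(4) inE(1) neq(3)] step[OF cuts(4) inE(2) neq(8)]
      step[OF cuts(4) inE(3) neq(13)] step[OF cuts(4) inE(5) neq(24)] step[OF cuts(4) inE(6) neq(29)]
    by blast+
  have sC: "s \<notin> C" "\<alpha> \<notin> C" "\<beta> \<notin> C" "m \<notin> C" "m' \<notin> C" "p \<notin> C" "p' \<notin> C" "t \<notin> C" "\<delta> \<notin> C"
    using ends[OF cuts(5)] cutF[OF cuts(5) inF(5) j(1)] cutF[OF cuts(5) inF(5) j(2)] cutF[OF cuts(5) inF(5) j(3)]
      step[OF cuts(5) inE(1) neq(4)] step[OF cuts(5) inE(2) neq(9)]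
      step[OF cuts(5) inE(3) neq(14)] step[OF cuts(5) inE(4) neq(19)] step[OF cuts(5) inE(6) neq(30)]
    by blast+
  have sD: "s \<notin> D" "\<alpha> \<notin> D" "\<beta> \<notin> D" "m \<notin> D" "m' \<notin> D" "p \<notin> D" "p' \<notin> D" "t \<notin> D" "\<gamma> \<notin> D"
    using ends[OF cuts(6)] cutF[OF cuts(6) inF(6) j(1)] cutF[OF cuts(6) inF(6) j(2)] cutF[OF cuts(6) inF(6) j(3)]
      step[OF cuts(6) inE(1) neq(5)] step[OF cuts(6) inE(2) neq(10)]
      step[OF cuts(6) inE(3) neq(15)] step[OF cuts(6) inE(4) neq(20)] step[OF cuts(6) inE(5) neq(25)]
    by blast+
  have vals: "g s = Nu" "g \<alpha> = Na" "g \<beta> = Nb" "g m = Nu" "g m' = Nm" "g p = Nm" "g p' = Nv"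
    "g t = Nv" "g \<gamma> = Nc" "g \<delta> = Nd"
    using sA sB sC sD sP sM ends(1)[OF cuts(1)] ends(1)[OF cuts(2)] ends(1)[OF cuts(5)]
      ends(1)[OF cuts(6)] by (simp_all add: g_def)
  have same: "g u = g v" if "{u, v} \<in> E - F" for u v
  proof -
    have uv: "{u, v} \<in> E" using that by blast
    have ne: "{u, v} \<noteq> e" if "e \<in> F" for e using that \<open>{u, v} \<in> E - F\<close> by blast
    show ?thesis
      using step[OF cuts(1) uv ne[OF inF(1)]] step[OF cuts(2) uv ne[OF inF(2)]]
        step[OF cuts(3) uv ne[OF inF(3)]] step[OF cuts(4) uv ne[OF inF(4)]]
        step[OF cuts(5) uv ne[OF inF(5)]] step[OF cuts(6) uv ne[OF inF(6)]]
      by (simp add: g_def)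
  qed
  \<comment> \<open>One vertex per component. Along a walk from \<open>s\<close>, every vertex
    reached is linked to the representative of its component by edges outside
    \<open>F\<close>.\<close>
  define rep where "rep n = (case n of Na \<Rightarrow> \<alpha> | Nb \<Rightarrow> \<beta> | Nu \<Rightarrow> s | Nm \<Rightarrow> m' | Nv \<Rightarrow> t | Nc \<Rightarrow> \<gamma> | Nd \<Rightarrow> \<delta>)" for n
  have toRep: "joined (E - F) (rep (g z)) z" if z: "z \<in> verts T" for z
  proof -
    have "joined E s z" using joined_all[of s z] z edge_verts inE by blast
    then show ?thesis
    proof (induction rule: joined_induct)
      case refl
      then show ?case by (simp add: vals rep_def)
    next
      case (step u v)
      show ?case
      proof (cases "{u, v} \<in> F")
        case True
        then have "v \<in> {s, \<alpha>, \<beta>, m, m', p, p', t, \<gamma>, \<delta>}" unfolding F by (auto simp: doubleton_eq_iff)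
        then show ?thesis using vals j joined_sym[OF j(3)] by (auto simp: rep_def)
      next
        case False
        then have "{u, v} \<in> E - F" using step by blast
        then show ?thesis using step(3) same joined_step by metis
      qed
    qed
  qed
  have "joined (E - F) u v" if "u \<in> verts T" "v \<in> verts T" "g u = g v" for u v
    using toRep[OF that(1)] toRep[OF that(2)] that(3) joined_sym joined_trans by metis
  then show ?thesis using that[OF vals same] by blast
qed

end

section \<open>Transport along isomorphisms\<close>

lemma simple_path_map:
  assumes "simple_path T xs" "inj_on f (verts T)" "f ` verts T \<subseteq> verts T'" "(`) f ` edges T \<subseteq> edges T'"
  shows "simple_path T' (map f xs)"
proof -
  have "inj_on f (set xs)" using assms(1,2) by (auto simp: simple_path_def intro: inj_on_subset)
  moreover have "set (map f xs) \<subseteq> verts T'" using assms(1,3) by (auto simp: simple_path_def)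
  moreover have "path_edges (map f xs) \<subseteq> edges T'"
    using assms(1,4) unfolding path_edges_map simple_path_def by blast
  ultimately show ?thesis using assms(1) by (simp add: simple_path_def distinct_map)
qed

text \<open>Paths are pushed forward by \<open>f\<close>, while a cycle of \<open>T'\<close> is
  pulled back by the inverse.\<close>

lemma tree_transport:
  assumes T: "tree T" and f: "bij_betw f (verts T) (verts T')" "edges T' = (`) f ` edges T"
  shows "tree T'"
proof -
  have inj: "inj_on f (verts T)" and img: "f ` verts T = verts T'"
    using f(1) by (auto simp: bij_betw_def)
  have ed: "e \<subseteq> verts T" "card e = 2" if "e \<in> edges T" for e
    using that T by (auto simp: tree_def simple_graph_def)
  define h where "h = inv_into (verts T) f"
  have hf: "h ` f ` e = e" if "e \<in> edges T" for e
    using inv_into_image_cancel[OF inj] ed(1) that by (simp add: h_def)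
  have "simple_graph T'"
    unfolding simple_graph_def
  proof (intro conjI ballI)
    show "finite (verts T')"
      unfolding img[symmetric] using T by (simp add: tree_def simple_graph_def)
    fix e assume "e \<in> edges T'"
    then obtain e' where e': "e' \<in> edges T" "e = f ` e'" using f(2) by auto
    then show "e \<subseteq> verts T'" using ed(1)[OF e'(1)] img by blast
    show "card e = 2" using e' ed inj card_image[of f e'] inj_on_subset by metis
  qed
  moreover have "connected_graph T'"
    unfolding connected_graph_def
  proof (intro conjI ballI)
    show "verts T' \<noteq> {}" using T img by (auto simp: tree_def connected_graph_def)
    fix x y assume "x \<in> verts T'" "y \<in> verts T'"
    then obtain x' y' where x': "x' \<in> verts T" "y' \<in> verts T" "x = f x'" "y = f y'" using img by blast
    then obtain xs where xs: "simple_path T xs" "hd xs = x'" "last xs = y'"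
      using T unfolding tree_def connected_graph_def by blast
    have "simple_path T' (map f xs)"
      by (rule simple_path_map[OF xs(1) inj]) (use img f(2) in auto)
    then show "\<exists>xs. simple_path T' xs \<and> hd xs = x \<and> last xs = y"
      using xs x' by (intro exI[of _ "map f xs"]) (auto simp: simple_path_def hd_map last_map)
  qed
  moreover have False if C: "cycle_graph C" "subgraph C T'" for C
  proof -
    obtain xs where xs: "length xs \<ge> 3" "distinct xs" "verts C = set xs" "edges C = cycle_edges xs"
      using C(1) by (auto simp: cycle_graph_def)
    have sub: "set xs \<subseteq> verts T'" "cycle_edges xs \<subseteq> (`) f ` edges T"
      using C(2) xs f(2) by (auto simp: subgraph_def)
    have injh: "inj_on h (verts T')" and imgh: "h ` verts T' = verts T"
      using bij_betw_inv_into[OF f(1)] by (auto simp: bij_betw_def h_def)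
    have "xs \<noteq> []" using xs(1) by auto
    then have "cycle_edges (map h xs) = (`) h ` cycle_edges xs"
      using path_edges_map[of h "xs @ [hd xs]"] by (simp add: cycle_edges_def hd_map)
    moreover have "(`) h ` cycle_edges xs \<subseteq> edges T" using sub(2) hf by auto
    moreover have "set (map h xs) \<subseteq> verts T" using sub(1) imgh by auto
    moreover have "distinct (map h xs)"
      using xs(2) inj_on_subset[OF injh sub(1)] by (simp add: distinct_map)
    ultimately have "cycle_graph \<lparr>verts = set (map h xs), edges = cycle_edges (map h xs)\<rparr>"
      "subgraph \<lparr>verts = set (map h xs), edges = cycle_edges (map h xs)\<rparr> T"
      using xs(1) unfolding cycle_graph_def subgraph_def
      by (auto intro!: exI[of _ "map h xs"])
    then show False using T by (auto simp: tree_def)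
  qed
  ultimately show ?thesis unfolding tree_def by blast
qed

text \<open>Serves the uniqueness proof: the contracted representation is known only up to
  isomorphism and must be seen to represent the pair before minimality applies.\<close>

lemma represents_transport:
  assumes R: "represents R G C" and iso: "rep_isomorphic (verts G) R R'"
  shows "represents R' G C"
proof -
  obtain f where f: "bij_betw f (verts (host R)) (verts (host R'))"
    "edges (host R') = (`) f ` edges (host R)" "\<And>v. v \<in> verts G \<Longrightarrow> rpath R' v = (`) f ` rpath R v"
    using iso by (auto simp: rep_isomorphic_def)
  have rep: "is_representation (verts G) R" using R by (simp add: represents_def)
  then have T: "tree (host R)" by (simp add: is_representation_def)
  have inj: "inj_on f (verts (host R))" and img: "f ` verts (host R) = verts (host R')"
    using f(1) by (auto simp: bij_betw_def)
  have ed: "e \<subseteq> verts (host R)" if "e \<in> edges (host R)" for e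
    using that T by (auto simp: tree_def simple_graph_def)
  have sub: "rpath R v \<subseteq> edges (host R)" "finite (rpath R v)" if "v \<in> verts G" for v
    using rep that by (auto simp: is_representation_def simple_path_def)
  have injE: "inj_on ((`) f) (edges (host R))"
    using inj_on_image_Pow[OF inj] by (rule inj_on_subset) (use ed in blast)
  have "is_representation (verts G) R'"
    unfolding is_representation_def
  proof (intro conjI ballI)
    show "tree (host R')" using tree_transport[OF T f(1,2)] .
    fix v assume v: "v \<in> verts G"
    then obtain xs where xs: "simple_path (host R) xs" "length xs \<ge> 2" "rpath R v = path_edges xs"
      using rep by (auto simp: is_representation_def)
    have "simple_path (host R') (map f xs)"
      by (rule simple_path_map[OF xs(1) inj]) (use img f(2) in auto)
    then show "\<exists>xs. simple_path (host R') xs \<and> 2 \<le> length xs \<and> rpath R' v = path_edges xs"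
      using xs f(3)[OF v] path_edges_map[of f xs] by (intro exI[of _ "map f xs"]) simp
  qed
  moreover have "intersecting (rpath R' u) (rpath R' v) \<longleftrightarrow> intersecting (rpath R u) (rpath R v)"
    if "u \<in> verts G" "v \<in> verts G" for u v
    using inj_on_image_Int[OF injE sub(1)[OF that(1)] sub(1)[OF that(2)]] f(3) that
    unfolding intersecting_def by (metis image_is_empty)
  moreover have "split_vertices (rpath R' u) (rpath R' v) = {} \<longleftrightarrow> split_vertices (rpath R u) (rpath R v) = {}"
    if u: "u \<in> verts G" and v: "v \<in> verts G" for u v
  proof -
    let ?P = "rpath R u \<union> rpath R v"
    have P: "?P \<subseteq> edges (host R)" using sub u v by blast
    have P': "rpath R' u \<union> rpath R' v = (`) f ` ?P" using f(3) u v by (simp add: image_Un)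
    have deg: "card {e \<in> (`) f ` ?P. f x \<in> e} = card {e \<in> ?P. x \<in> e}" if x: "x \<in> verts (host R)" for x
    proof -
      have "f x \<in> f ` e \<longleftrightarrow> x \<in> e" if "e \<in> ?P" for e
        using inj_on_image_mem_iff[OF inj x] ed that P by blast
      then have "{e \<in> (`) f ` ?P. f x \<in> e} = (`) f ` {e \<in> ?P. x \<in> e}" by blast
      moreover have "inj_on ((`) f) {e \<in> ?P. x \<in> e}"
        using injE by (rule inj_on_subset) (use P in blast)
      ultimately show ?thesis by (simp add: card_image)
    qed
    \<comment> \<open>\<open>split_vertices\<close> ranges over the whole type; a vertex of degree
      at least 3 lies on an edge and hence in the host, where \<open>f\<close> is injective.\<close>
    have pos: "\<exists>e\<in>Q. x \<in> e" if "3 \<le> card {e \<in> Q. x \<in> e}" for Q :: "'x set set" and x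
    proof (rule ccontr)
      assume "\<not> (\<exists>e\<in>Q. x \<in> e)"
      then have "{e \<in> Q. x \<in> e} = {}" by blast
      then show False using that by (metis card.empty not_numeral_le_zero)
    qed
    have "split_vertices (rpath R' u) (rpath R' v) = f ` split_vertices (rpath R u) (rpath R v)"
    proof (intro equalityI subsetI)
      fix y assume y: "y \<in> split_vertices (rpath R' u) (rpath R' v)"
      then have y3: "3 \<le> card {e \<in> (`) f ` ?P. y \<in> e}" unfolding split_vertices_def P' by blast
      from pos[OF this] obtain e where "e \<in> ?P" "y \<in> f ` e" by blast
      then obtain x where "x \<in> verts (host R)" "y = f x" using ed P by blast
      then show "y \<in> f ` split_vertices (rpath R u) (rpath R v)"
        using y3 deg unfolding split_vertices_def by auto
    next
      fix y assume "y \<in> f ` split_vertices (rpath R u) (rpath R v)"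
      then obtain x where x: "3 \<le> card {e \<in> ?P. x \<in> e}" "y = f x" unfolding split_vertices_def by blast
      from pos[OF x(1)] have "x \<in> verts (host R)" using ed P by blast
      then show "y \<in> split_vertices (rpath R' u) (rpath R' v)"
        using x deg unfolding split_vertices_def P' by simp
    qed
    then show ?thesis by simp
  qed
  ultimately show ?thesis using R unfolding represents_def nonsplitting_def by simp
qed

section \<open>The canonical representation\<close>

lemma canonical_tree_tree: "tree canonical_tree"
proof -
  have sg: "simple_graph canonical_tree"
    by (auto simp: simple_graph_def canonical_tree_def)
  have adj: "joined (edges canonical_tree) Nm x" if "x \<in> verts canonical_tree" for x
  proof -
    have "joined (edges canonical_tree) Nm Nu" "joined (edges canonical_tree) Nm Nv"
      by (rule joined_step[of _ Nm Nm]; simp add: canonical_tree_def insert_commute)+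
    moreover have "joined (edges canonical_tree) Nm Na" "joined (edges canonical_tree) Nm Nb"
      by (rule joined_step[OF calculation(1)]; simp add: canonical_tree_def insert_commute)+
    moreover have "joined (edges canonical_tree) Nm Nc" "joined (edges canonical_tree) Nm Nd"
      by (rule joined_step[OF calculation(2)]; simp add: canonical_tree_def insert_commute)+
    ultimately show ?thesis using that by (auto simp: canonical_tree_def)
  qed
  have "connected_graph canonical_tree"
    unfolding connected_graph_def
  proof (intro conjI ballI)
    show "verts canonical_tree \<noteq> {}" by (simp add: canonical_tree_def)
    fix x y assume "x \<in> verts canonical_tree" "y \<in> verts canonical_tree"
    then have "joined (edges canonical_tree) x y" using adj joined_sym joined_trans by metis
    then obtain xs where xs: "xs \<noteq> []" "distinct xs" "hd xs = x" "last xs = y"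
      "path_edges xs \<subseteq> edges canonical_tree" using joined_imp_path by metis
    moreover have "z \<in> verts canonical_tree" for z by (cases z) (auto simp: canonical_tree_def)
    ultimately show "\<exists>xs. simple_path canonical_tree xs \<and> hd xs = x \<and> last xs = y"
      unfolding simple_path_def by blast
  qed
  moreover have False if "cycle_graph C" "subgraph C canonical_tree" for C
  proof (rule cut_edges_imp_acyclic[OF _ that(1)])
    show "edges C \<subseteq> edges canonical_tree" using that(2) by (simp add: subgraph_def)
    fix x y assume xy: "{x, y} \<in> edges canonical_tree" "x \<noteq> y"
    \<comment> \<open>One side of each of the six bridges. If that side does not contain
      \<open>y\<close>, its complement is taken.\<close>
    define cuts where "cuts e = (if e = {Na, Nu} then {Na} else if e = {Nb, Nu} then {Nb}
       else if e = {Nu, Nm} then {Na, Nb, Nu} else if e = {Nm, Nv} then {Nv, Nc, Nd}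
       else if e = {Nv, Nc} then {Nc} else {Nd})" for e
    define X where "X = (if y \<in> cuts {x, y} then cuts {x, y} else - cuts {x, y})"
    have "y \<in> X \<and> x \<notin> X \<and> (\<forall>u v. {u, v} \<in> edges canonical_tree \<longrightarrow> {u, v} \<noteq> {x, y} \<longrightarrow> (u \<in> X) = (v \<in> X))"
      using xy unfolding X_def cuts_def canonical_tree_def
      by (auto simp: doubleton_eq_iff)
    then show "\<exists>X. y \<in> X \<and> x \<notin> X \<and>
        (\<forall>u v. {u, v} \<in> edges canonical_tree \<longrightarrow> {u, v} \<noteq> {x, y} \<longrightarrow> (u \<in> X) = (v \<in> X))" by blast
  qed
  ultimately show ?thesis using sg by (auto simp: tree_def)
qed

lemma canonical_rpath:
  assumes "distinct [v0, v1, v2, v3, v4]"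
  shows "rpath (canonical_rep v0 v1 v2 v3 v4) v0 = path_edges [Na, Nu, Nm, Nv]"
    "rpath (canonical_rep v0 v1 v2 v3 v4) v1 = path_edges [Nu, Nm, Nv, Nc]"
    "rpath (canonical_rep v0 v1 v2 v3 v4) v2 = path_edges [Nb, Nu, Nm]"
    "rpath (canonical_rep v0 v1 v2 v3 v4) v3 = path_edges [Nb, Nu, Nm, Nv, Nd]"
    "rpath (canonical_rep v0 v1 v2 v3 v4) v4 = path_edges [Nm, Nv, Nd]"
  using assms by (auto simp: canonical_rep_def)

lemma host_canonical [simp]: "host (canonical_rep v0 v1 v2 v3 v4) = canonical_tree"
  by (simp add: canonical_rep_def)

text \<open>Nonsplitting pairs lie on a common path of the tree. The split pairs have degree 3 at
  \<open>Nu\<close> (02 and 03) or at \<open>Nv\<close> (13 and 14).\<close>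

lemma canonical_pairs:
  defines "p0 \<equiv> path_edges [Na, Nu, Nm, Nv]" and "p1 \<equiv> path_edges [Nu, Nm, Nv, Nc]"
    and "p2 \<equiv> path_edges [Nb, Nu, Nm]" and "p3 \<equiv> path_edges [Nb, Nu, Nm, Nv, Nd]"
    and "p4 \<equiv> path_edges [Nm, Nv, Nd]"
  shows "nonsplitting p0 p1" "nonsplitting p1 p2" "nonsplitting p2 p3" "nonsplitting p3 p4"
    "nonsplitting p4 p0"
    "intersecting p0 p2" "intersecting p0 p3" "intersecting p1 p3" "intersecting p1 p4"
    "\<not> nonsplitting p0 p2" "\<not> nonsplitting p0 p3" "\<not> nonsplitting p1 p3" "\<not> nonsplitting p1 p4"
    "\<not> intersecting p2 p4"
proof -
  note defs = p0_def p1_def p2_def p3_def p4_def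
  show "nonsplitting p0 p1" unfolding nonsplitting_def
    by (intro conjI split_vertices_within_path[of "[Na, Nu, Nm, Nv, Nc]"])
       (auto simp: defs intersecting_def)
  show "nonsplitting p1 p2" unfolding nonsplitting_def
    by (intro conjI split_vertices_within_path[of "[Nb, Nu, Nm, Nv, Nc]"])
       (auto simp: defs intersecting_def)
  show "nonsplitting p2 p3" "nonsplitting p3 p4" unfolding nonsplitting_def
    by (intro conjI split_vertices_within_path[of "[Nb, Nu, Nm, Nv, Nd]"];
       auto simp: defs intersecting_def)+
  show "nonsplitting p4 p0" unfolding nonsplitting_def
    by (intro conjI split_vertices_within_path[of "[Na, Nu, Nm, Nv, Nd]"])
       (auto simp: defs intersecting_def)
  show "intersecting p0 p2" "intersecting p0 p3" "intersecting p1 p3" "intersecting p1 p4"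
    by (auto simp: defs intersecting_def)
  show "\<not> intersecting p2 p4" by (auto simp: defs intersecting_def doubleton_eq_iff)
  have "split_vertices p0 p2 \<noteq> {}" "split_vertices p0 p3 \<noteq> {}"
    by (rule split_vertices_nonempty[of _ _ "{Na, Nu}" "{Nb, Nu}" "{Nu, Nm}" Nu];
        simp add: defs doubleton_eq_iff)+
  moreover have "split_vertices p1 p3 \<noteq> {}" "split_vertices p1 p4 \<noteq> {}"
    by (rule split_vertices_nonempty[of _ _ "{Nv, Nc}" "{Nv, Nd}" "{Nm, Nv}" Nv];
        simp add: defs doubleton_eq_iff)+
  ultimately show "\<not> nonsplitting p0 p2" "\<not> nonsplitting p0 p3" "\<not> nonsplitting p1 p3"
    "\<not> nonsplitting p1 p4" by (simp_all add: nonsplitting_def)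
qed

lemma canonical_represents:
  assumes d: "distinct [v0, v1, v2, v3, v4]" and V: "verts G = {v0, v1, v2, v3, v4}"
    and C: "edges C = cycle_edges [v0, v1, v2, v3, v4]"
    and G: "edges G = edges C \<union> {{v0, v2}, {v0, v3}, {v1, v3}, {v1, v4}}"
  shows "represents (canonical_rep v0 v1 v2 v3 v4) G C"
  unfolding represents_def
proof (intro conjI ballI impI)
  note rp = canonical_rpath[OF d]
  have path: "simple_path canonical_tree xs" if "xs \<noteq> []" "distinct xs" "path_edges xs \<subseteq> edges canonical_tree" for xs
  proof -
    have "z \<in> verts canonical_tree" for z by (cases z) (auto simp: canonical_tree_def)
    then show ?thesis using that by (auto simp: simple_path_def)
  qed
  show "is_representation (verts G) (canonical_rep v0 v1 v2 v3 v4)"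
    unfolding is_representation_def host_canonical
  proof (intro conjI ballI)
    show "tree canonical_tree" by (rule canonical_tree_tree)
    fix v assume "v \<in> verts G"
    have "simple_path canonical_tree [Na, Nu, Nm, Nv]" "simple_path canonical_tree [Nu, Nm, Nv, Nc]"
      "simple_path canonical_tree [Nb, Nu, Nm]" "simple_path canonical_tree [Nb, Nu, Nm, Nv, Nd]"
      "simple_path canonical_tree [Nm, Nv, Nd]"
      by (rule path; simp add: canonical_tree_def)+
    note paths = this
    have "\<exists>xs. simple_path canonical_tree xs \<and> 2 \<le> length xs \<and>
       rpath (canonical_rep v0 v1 v2 v3 v4) w = path_edges xs"
      if "rpath (canonical_rep v0 v1 v2 v3 v4) w = path_edges ys" "simple_path canonical_tree ys"
        "2 \<le> length ys" for w ys
      using that by blast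
    from this[OF rp(1) paths(1)] this[OF rp(2) paths(2)] this[OF rp(3) paths(3)]
      this[OF rp(4) paths(4)] this[OF rp(5) paths(5)]
    show "\<exists>xs. simple_path canonical_tree xs \<and> 2 \<le> length xs \<and>
       rpath (canonical_rep v0 v1 v2 v3 v4) v = path_edges xs" using \<open>v \<in> verts G\<close> unfolding V by auto
  qed
  fix u v assume u: "u \<in> verts G" and v: "v \<in> verts G" and uv: "u \<noteq> v"
  have ne: "\<not> nonsplitting (path_edges [Nb, Nu, Nm]) (path_edges [Nm, Nv, Nd])"
    using canonical_pairs(14) by (simp add: nonsplitting_def)
  have int: "intersecting P Q" if "nonsplitting P Q" for P Q :: "node set set"
    using that by (simp add: nonsplitting_def)
  note pairs = canonical_pairs canonical_pairs(1-5)[THEN int] ne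
  have d': "distinct [v4, v3, v2, v1, v0]" using d by auto
  have C': "edges C = {{v0, v1}, {v1, v2}, {v2, v3}, {v3, v4}, {v4, v0}}"
    by (simp add: C cycle_edges_def)
  have G': "edges G = {{v0, v1}, {v1, v2}, {v2, v3}, {v3, v4}, {v4, v0}, {v0, v2}, {v0, v3}, {v1, v3}, {v1, v4}}"
    unfolding G C' by auto
  let ?R = "canonical_rep v0 v1 v2 v3 v4"
  \<comment> \<open>The condition is symmetric, so ten of the twenty ordered pairs suffice.\<close>
  define ok where "ok u v \<longleftrightarrow> ({u, v} \<in> edges G) = intersecting (rpath ?R u) (rpath ?R v) \<and>
    ({u, v} \<in> edges C) = nonsplitting (rpath ?R u) (rpath ?R v)" for u v
  have comm: "ok v u" if "ok u v" for u v
    using that unfolding ok_def insert_commute[of v u] intersecting_commute[of "rpath ?R v"]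
      nonsplitting_commute[of "rpath ?R v"] .
  have oks: "ok v0 v1" "ok v1 v2" "ok v2 v3" "ok v3 v4" "ok v4 v0" "ok v0 v2" "ok v0 v3" "ok v1 v3"
    "ok v1 v4" "ok v2 v4"
    unfolding ok_def rp using d d' pairs unfolding G' C'
    by (simp_all add: doubleton_eq_iff del: path_edges.simps)
  have "ok u v" using u v uv oks oks[THEN comm] unfolding V by auto
  then show "({u, v} \<in> edges G) = intersecting (rpath ?R u) (rpath ?R v)"
    "({u, v} \<in> edges C) = nonsplitting (rpath ?R u) (rpath ?R v)" by (simp_all add: ok_def)
qed

text \<open>In the normal form of \<open>R'\<close>, intersections force \<open>e\<close> and
  \<open>f\<close> to survive; this confines the fibres of the contraction, so that the splits force
  \<open>a\<close>, \<open>b\<close>, \<open>c\<close> and \<open>d'\<close>; connectedness settles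
  the middle of the path of \<open>v3\<close>.\<close>

lemma minify_canonical:
  assumes d: "distinct [v0, v1, v2, v3, v4]" and V: "verts G = {v0, v1, v2, v3, v4}"
    and C: "edges C = cycle_edges [v0, v1, v2, v3, v4]"
    and G: "edges G = edges C \<union> {{v0, v2}, {v0, v3}, {v1, v3}, {v1, v4}}"
    and min: "(minify (verts G))\<^sup>*\<^sup>* (canonical_rep v0 v1 v2 v3 v4) R'" and R': "represents R' G C"
  shows "rep_isomorphic (verts G) (canonical_rep v0 v1 v2 v3 v4) R'"
proof -
  interpret tree_graph canonical_tree by unfold_locales (rule canonical_tree_tree)
  define a b e f c d' where abefcd: "a = {Na, Nu}" "b = {Nb, Nu}" "e = {Nu, Nm}" "f = {Nm, Nv}"
    "c = {Nv, Nc}" "d' = {Nv, Nd}"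
  have E: "E = {a, b, e, f, c, d'}" by (simp add: canonical_tree_def abefcd)
  have dist: "distinct [a, b, e, f, c, d']" and dist': "distinct [d', c, f, e, b, a]"
    by (simp_all add: abefcd doubleton_eq_iff)
  have univ: "z \<in> verts canonical_tree" for z by (cases z) (auto simp: canonical_tree_def)
  let ?R = "canonical_rep v0 v1 v2 v3 v4"
  have rp: "rpath ?R v0 = {a, e, f}" "rpath ?R v1 = {e, f, c}" "rpath ?R v2 = {b, e}"
    "rpath ?R v3 = {b, e, f, d'}" "rpath ?R v4 = {f, d'}"
    using canonical_rpath[OF d] by (simp_all add: abefcd)
  have ed: "\<forall>e\<in>edges (host ?R). \<exists>x y. e = {x, y} \<and> x \<in> verts (host ?R) \<and> y \<in> verts (host ?R)"
    using univ E by (auto simp: abefcd)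
  have rpE: "\<forall>v\<in>verts G. rpath ?R v \<subseteq> edges (host ?R)"
    using rp unfolding V by (auto simp: E)
  obtain \<phi> D S where "verts (host R') = \<phi> ` verts (host ?R) \<and> D \<subseteq> edges (host ?R) \<and>
    edges (host R') = (`) \<phi> ` (edges (host ?R) - D) \<and>
    (\<forall>v\<in>verts G. S v \<subseteq> rpath ?R v - D \<and> rpath R' v = (`) \<phi> ` S v) \<and>
    (\<forall>x\<in>verts (host ?R). \<forall>y\<in>verts (host ?R). \<phi> x = \<phi> y \<longrightarrow> joined D x y)"
    using minify_normal_form[OF min ed rpE] by (elim exE) (rule that)
  then have nf: "verts (host R') = \<phi> ` verts canonical_tree" "D \<subseteq> E"
    "edges (host R') = (`) \<phi> ` (E - D)"
    "\<And>v. v \<in> verts G \<Longrightarrow> S v \<subseteq> rpath ?R v - D" "\<And>v. v \<in> verts G \<Longrightarrow> rpath R' v = (`) \<phi> ` S v"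
    "\<And>x y. \<phi> x = \<phi> y \<Longrightarrow> joined D x y"
    using univ by simp_all
  have inV: "v0 \<in> verts G" "v1 \<in> verts G" "v2 \<in> verts G" "v3 \<in> verts G" "v4 \<in> verts G"
    using V by auto
  have S: "S v0 \<subseteq> {a, e, f} - D" "S v1 \<subseteq> {e, f, c} - D" "S v2 \<subseteq> {b, e} - D"
    "S v3 \<subseteq> {b, e, f, d'} - D" "S v4 \<subseteq> {f, d'} - D"
    using nf(4)[OF inV(1)] nf(4)[OF inV(2)] nf(4)[OF inV(3)] nf(4)[OF inV(4)] nf(4)[OF inV(5)]
    unfolding rp .
  have SE: "S v \<subseteq> E - D" if "v \<in> verts G" for v
    using nf(4)[OF that] rpE that by auto
  \<comment> \<open>No contracted edge crosses the bridge \<open>e1\<close>, so the fibres of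
    \<open>\<phi>\<close> respect its two sides. Both ends of \<open>e2\<close> lie on one side,
    hence cannot account for both ends of \<open>e1\<close>.\<close>
  have inj: "e1 = e2" if e12: "e1 \<in> E - D" "e2 \<in> E - D" "\<phi> ` e1 = \<phi> ` e2" for e1 e2
  proof (rule ccontr)
    assume ne: "e1 \<noteq> e2"
    obtain x y where xy: "e1 = {x, y}" using e12(1) E by (auto simp: abefcd)
    obtain u v where uv: "e2 = {u, v}" using e12(2) E by (auto simp: abefcd)
    obtain X where X: "y \<in> X" "x \<notin> X" "\<And>u v. {u, v} \<in> E \<Longrightarrow> {u, v} \<noteq> {x, y} \<Longrightarrow> u \<in> X \<longleftrightarrow> v \<in> X"
      using cut[of x y] e12(1) xy by auto
    have D: "p \<in> X \<longleftrightarrow> q \<in> X" if "\<phi> p = \<phi> q" for p q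
    proof (rule joined_cut[OF nf(6)[OF that]])
      fix p q assume pq: "{p, q} \<in> D"
      then have "{p, q} \<noteq> {x, y}" using e12(1) xy by auto
      then show "p \<in> X \<longleftrightarrow> q \<in> X" using X(3) pq nf(2) by blast
    qed
    have "u \<in> X \<longleftrightarrow> v \<in> X" using X(3)[of u v] e12(2) uv ne xy by auto
    moreover have "\<phi> x \<in> {\<phi> u, \<phi> v}" "\<phi> y \<in> {\<phi> u, \<phi> v}" using e12(3) xy uv by auto
    ultimately show False using D X(1,2) by (metis empty_iff insert_iff)
  qed
  have meet: "S u \<inter> S v \<noteq> {}" if uv: "u \<in> verts G" "v \<in> verts G" "u \<noteq> v" "{u, v} \<in> edges G" for u v
  proof -
    have "intersecting (rpath R' u) (rpath R' v)" using R' uv unfolding represents_def by blast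
    then obtain e1 e2 where "e1 \<in> S u" "e2 \<in> S v" "\<phi> ` e1 = \<phi> ` e2"
      unfolding intersecting_def nf(5)[OF uv(1)] nf(5)[OF uv(2)] by blast
    then show ?thesis using inj[of e1 e2] SE[OF uv(1)] SE[OF uv(2)] by blast
  qed
  have C': "edges C = {{v0, v1}, {v1, v2}, {v2, v3}, {v3, v4}, {v4, v0}}"
    by (simp add: C cycle_edges_def)
  have inG: "{v0, v2} \<in> edges G" "{v0, v4} \<in> edges G" "{v1, v2} \<in> edges G" "{v1, v4} \<in> edges G"
    "{v0, v3} \<in> edges G" "{v1, v3} \<in> edges G" using G C' by (auto simp: insert_commute)
  have ne: "v0 \<noteq> v2" "v0 \<noteq> v4" "v1 \<noteq> v2" "v1 \<noteq> v4" "v0 \<noteq> v3" "v1 \<noteq> v3" using d by auto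
  have notin: "x \<notin> A" if "A \<subseteq> N - D" "x \<notin> N" for x A N using that by blast
  have not0: "b \<notin> S v0" "c \<notin> S v0" "d' \<notin> S v0" by (rule notin[OF S(1)], use dist dist' in simp)+
  have not1: "a \<notin> S v1" "b \<notin> S v1" "d' \<notin> S v1" by (rule notin[OF S(2)], use dist dist' in simp)+
  have not2: "a \<notin> S v2" "f \<notin> S v2" "c \<notin> S v2" by (rule notin[OF S(3)], use dist dist' in simp)+
  have not3: "a \<notin> S v3" "c \<notin> S v3" by (rule notin[OF S(4)], use dist dist' in simp)+
  have not4: "a \<notin> S v4" "c \<notin> S v4" "e \<notin> S v4" by (rule notin[OF S(5)], use dist dist' in simp)+
  \<comment> \<open>Each of these pairs of canonical paths has exactly one common edge,
    \<open>e\<close> or \<open>f\<close>.\<close>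
  have e02: "e \<in> S v0" "e \<in> S v2" using meet[OF inV(1,3) ne(1) inG(1)] S(1) not2 by blast+
  have f04: "f \<in> S v0" "f \<in> S v4" using meet[OF inV(1,5) ne(2) inG(2)] S(1) not4 by blast+
  have e1: "e \<in> S v1" using meet[OF inV(2,3) ne(3) inG(3)] S(2) not2 by blast
  have f1: "f \<in> S v1" using meet[OF inV(2,5) ne(4) inG(4)] S(2) not4 by blast
  note ef = e02 f04 e1 f1
  have efD: "e \<notin> D" "f \<notin> D" using e02 f04 S(1) by blast+
  \<comment> \<open>As \<open>e\<close> and \<open>f\<close> survive, the fibre of a split vertex
    lies in one of the three parts around \<open>Nu\<close>, \<open>Nm\<close>, \<open>Nv\<close>.
    The outer parts touch three edges each, the middle one only two.\<close>
  have split: "{a, b, e} \<subseteq> S u \<union> S v \<or> {c, d', f} \<subseteq> S u \<union> S v"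
    if uv: "u \<in> verts G" "v \<in> verts G" "u \<noteq> v" "{u, v} \<in> edges G" "{u, v} \<notin> edges C" for u v
  proof -
    let ?A = "S u \<union> S v"
    have "intersecting (rpath R' u) (rpath R' v)" "\<not> nonsplitting (rpath R' u) (rpath R' v)"
      using R' uv unfolding represents_def by blast+
    then have "split_vertices (rpath R' u) (rpath R' v) \<noteq> {}" by (simp add: nonsplitting_def)
    then obtain w where w: "3 \<le> card {h \<in> (`) \<phi> ` ?A. w \<in> h}"
      unfolding split_vertices_def nf(5)[OF uv(1)] nf(5)[OF uv(2)] image_Un[symmetric] by blast
    \<comment> \<open>If the edges at \<open>w\<close> come from a set \<open>N\<close> of at most
      three edges, then all of \<open>N\<close> is present.\<close>
    have big: "N \<subseteq> ?A \<and> card N = 3" if N: "\<And>h. h \<in> ?A \<Longrightarrow> w \<in> \<phi> ` h \<Longrightarrow> h \<in> N" "finite N" "card N \<le> 3" for N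
    proof -
      have "{h \<in> (`) \<phi> ` ?A. w \<in> h} \<subseteq> (`) \<phi> ` (N \<inter> ?A)" using N(1) by blast
      then have "card {h \<in> (`) \<phi> ` ?A. w \<in> h} \<le> card ((`) \<phi> ` (N \<inter> ?A))"
        using N(2) by (intro card_mono) auto
      also have "\<dots> \<le> card (N \<inter> ?A)" using N(2) by (intro card_image_le) auto
      finally have "3 \<le> card (N \<inter> ?A)" using w by simp
      moreover have "card (N \<inter> ?A) \<le> card N" using N(2) by (intro card_mono) auto
      ultimately have "card N = 3" "card (N \<inter> ?A) = card N" using N(3) by auto
      then have "N \<inter> ?A = N" using N(2) by (metis card_subset_eq inf_le1)
      then show ?thesis using \<open>card N = 3\<close> by blast
    qed
    have "{h \<in> (`) \<phi> ` ?A. w \<in> h} \<noteq> {}" using w by (metis card.empty not_numeral_le_zero)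
    then obtain z where z: "w = \<phi> z" by blast
    have same: "z \<in> X \<longleftrightarrow> y \<in> X" if "w = \<phi> y" "X = {Na, Nb, Nu} \<or> X = {Nv, Nc, Nd}" for y X
    proof (rule joined_cut[OF nf(6)])
      show "\<phi> z = \<phi> y" using z that by simp
      fix p q assume pq: "{p, q} \<in> D"
      then have "{p, q} \<in> {a, b, c, d'}" using nf(2) E efD by auto
      then show "p \<in> X \<longleftrightarrow> q \<in> X" using that(2) by (auto simp: abefcd doubleton_eq_iff)
    qed
    have AE: "?A \<subseteq> {a, b, e, f, c, d'}" using SE[OF uv(1)] SE[OF uv(2)] unfolding E by blast
    consider "z \<in> {Na, Nb, Nu}" | "z \<in> {Nv, Nc, Nd}" | "z = Nm" by (cases z) auto
    then show ?thesis
    proof cases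
      case 1
      have "{a, b, e} \<subseteq> ?A \<and> card {a, b, e} = 3"
      proof (rule big)
        fix h assume h: "h \<in> ?A" "w \<in> \<phi> ` h"
        then obtain y where y: "y \<in> h" "w = \<phi> y" by blast
        then have "y \<in> {Na, Nb, Nu}" using same[OF y(2), of "{Na, Nb, Nu}"] 1 by blast
        moreover have "h \<in> {a, b, e, f, c, d'}" using h AE by blast
        ultimately show "h \<in> {a, b, e}" using y(1) by (auto simp: abefcd)
      qed (auto simp: card_insert_if)
      then show ?thesis by blast
    next
      case 2
      have "{c, d', f} \<subseteq> ?A \<and> card {c, d', f} = 3"
      proof (rule big)
        fix h assume h: "h \<in> ?A" "w \<in> \<phi> ` h"
        then obtain y where y: "y \<in> h" "w = \<phi> y" by blast
        then have "y \<in> {Nv, Nc, Nd}" using same[OF y(2), of "{Nv, Nc, Nd}"] 2 by blast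
        moreover have "h \<in> {a, b, e, f, c, d'}" using h AE by blast
        ultimately show "h \<in> {c, d', f}" using y(1) by (auto simp: abefcd)
      qed (auto simp: card_insert_if)
      then show ?thesis by blast
    next
      case 3
      have "{e, f} \<subseteq> ?A \<and> card {e, f} = 3"
      proof (rule big)
        fix h assume h: "h \<in> ?A" "w \<in> \<phi> ` h"
        then obtain y where y: "y \<in> h" "w = \<phi> y" by blast
        then have "y \<notin> {Na, Nb, Nu}" "y \<notin> {Nv, Nc, Nd}"
          using same[OF y(2), of "{Na, Nb, Nu}"] same[OF y(2), of "{Nv, Nc, Nd}"] 3 by blast+
        moreover have "h \<in> {a, b, e, f, c, d'}" using h AE by blast
        ultimately show "h \<in> {e, f}" using y(1) by (auto simp: abefcd)
      qed (auto simp: card_insert_if)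
      then show ?thesis by (simp add: card_insert_if split: if_splits)
    qed
  qed
  have notC: "{v0, v2} \<notin> edges C" "{v0, v3} \<notin> edges C" "{v1, v3} \<notin> edges C" "{v1, v4} \<notin> edges C"
    using d unfolding C' by (auto simp: doubleton_eq_iff)
  \<comment> \<open>For each pair one triple is impossible, because \<open>c\<close> or
    \<open>a\<close> is on neither path; the other triple must then be complete.\<close>
  have ab2: "a \<in> S v0" "b \<in> S v2"
    using split[OF inV(1,3) ne(1) inG(1) notC(1)] not0 not2 by blast+
  have b3: "b \<in> S v3" using split[OF inV(1,4) ne(5) inG(5) notC(2)] not0 not3 by blast
  have cd3: "c \<in> S v1" "d' \<in> S v3"
    using split[OF inV(2,4) ne(6) inG(6) notC(3)] not1 not3 by blast+
  have d4: "d' \<in> S v4" using split[OF inV(2,5) ne(4) inG(4) notC(4)] not1 not4 by blast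
  note ab = ab2 b3 cd3 d4
  have "a \<notin> D" "b \<notin> D" "c \<notin> D" "d' \<notin> D"
    using ab(1) S(1) ab(2) S(3) ab(4) S(2) ab(5) S(4) by blast+
  then have D: "D = {}" using efD nf(2) unfolding E by blast
  have inj\<phi>: "inj \<phi>"
    by (rule injI, rule joined_empty, rule nf(6)[unfolded D])
  \<comment> \<open>This path contains \<open>b\<close> and \<open>d'\<close>; without
    \<open>e\<close> or without \<open>f\<close> it would fall into two vertex-disjoint
    parts.\<close>
  have S3: "e \<in> S v3 \<and> f \<in> S v3"
  proof (rule ccontr)
    assume no: "\<not> (e \<in> S v3 \<and> f \<in> S v3)"
    obtain xs where "rpath R' v3 = path_edges xs"
      using R' inV(4) unfolding represents_def is_representation_def by blast
    then have xs: "path_edges xs = (`) \<phi> ` S v3" using nf(5) inV by simp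
    have sep: False if N: "S v3 \<subseteq> N \<union> M" "\<Union>N \<inter> \<Union>M = {}" "b \<in> N" "d' \<in> M" for N M
    proof -
      have "\<Union>((`) \<phi> ` N) \<inter> \<Union>((`) \<phi> ` M) = \<phi> ` (\<Union>N \<inter> \<Union>M)"
        unfolding image_Int[OF inj\<phi>] by blast
      then have "\<Union>((`) \<phi> ` N) \<inter> \<Union>((`) \<phi> ` M) = {}" using N(2) by simp
      moreover have "path_edges xs \<subseteq> (`) \<phi> ` N \<union> (`) \<phi> ` M" unfolding xs image_Un[symmetric] by (rule image_mono[OF N(1)])
      ultimately have "path_edges xs \<subseteq> (`) \<phi> ` N \<or> path_edges xs \<subseteq> (`) \<phi> ` M"
        by (rule path_edges_within_one_part[rotated])
      then have "\<phi> ` d' \<in> (`) \<phi> ` N \<or> \<phi> ` b \<in> (`) \<phi> ` M"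
        using ab(3,5) unfolding xs by (meson image_eqI subsetD)
      then have "d' \<in> N \<or> b \<in> M" unfolding image_iff inj_image_eq_iff[OF inj\<phi>] by simp
      moreover have "Nd \<in> d'" "Nb \<in> b" by (simp_all add: abefcd)
      ultimately show False using N(2,3,4) by blast
    qed
    show False
    proof (cases "e \<in> S v3")
      case True
      then have "S v3 \<subseteq> {b, e} \<union> {d'}" using no S(4) by blast
      then show False by (rule sep) (auto simp: abefcd)
    next
      case False
      then have "S v3 \<subseteq> {b} \<union> {f, d'}" using S(4) by blast
      then show False by (rule sep) (auto simp: abefcd)
    qed
  qed
  have full: "A = N" if "A \<subseteq> N - D" "N \<subseteq> A" for A N using that by blast
  have "S v0 = rpath ?R v0" "S v1 = rpath ?R v1" "S v2 = rpath ?R v2" "S v3 = rpath ?R v3"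
    "S v4 = rpath ?R v4"
    unfolding rp by (rule full[OF S(1)] full[OF S(2)] full[OF S(3)] full[OF S(4)] full[OF S(5)],
      use ab ef S3 in simp)+
  then have "S v = rpath ?R v" if "v \<in> verts G" for v using that unfolding V by auto
  then have "\<forall>v\<in>verts G. rpath R' v = (`) \<phi> ` rpath ?R v" using nf(5) by simp
  moreover have "bij_betw \<phi> (verts (host ?R)) (verts (host R'))"
    using inj\<phi> nf(1) by (auto simp: bij_betw_def intro: inj_on_subset)
  moreover have "edges (host R') = (`) \<phi> ` edges (host ?R)" using nf(3) D by simp
  ultimately show ?thesis unfolding rep_isomorphic_def by blast
qed

section \<open>Reduction to the canonical representation\<close>

lemma skeletonE:
  assumes "skeleton T Q0 Q1 Q2 Q3 Q4"
  obtains s \<alpha> \<beta> m m' p p' t \<gamma> \<delta> F where "F = {{s, \<alpha>}, {s, \<beta>}, {m, m'}, {p, p'}, {t, \<gamma>}, {t, \<delta>}}"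
    "distinct [{s, \<alpha>}, {s, \<beta>}, {m, m'}, {p, p'}, {t, \<gamma>}, {t, \<delta>}]" "F \<subseteq> edges T"
    "joined (edges T - F) s m" "joined (edges T - F) m' p" "joined (edges T - F) p' t"
    "Q0 \<inter> F = {{s, \<alpha>}, {m, m'}, {p, p'}}" "Q1 \<inter> F = {{m, m'}, {p, p'}, {t, \<gamma>}}"
    "Q2 \<inter> F = {{s, \<beta>}, {m, m'}}" "Q3 \<inter> F = {{s, \<beta>}, {m, m'}, {p, p'}, {t, \<delta>}}"
    "Q4 \<inter> F = {{p, p'}, {t, \<delta>}}"
  using assms unfolding skeleton_def Let_def by (elim exE conjE) (rule that[OF refl])

lemma represents_iff:
  assumes "represents R G C" "u \<in> verts G" "v \<in> verts G" "u \<noteq> v"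
  shows "intersecting (rpath R u) (rpath R v) \<longleftrightarrow> {u, v} \<in> edges G"
    "nonsplitting (rpath R u) (rpath R v) \<longleftrightarrow> {u, v} \<in> edges C"
  using assms unfolding represents_def by simp_all

text \<open>Only chords among \<open>v0\<close>, \<open>v1\<close>, \<open>v2\<close>,
  \<open>v3\<close> are assumed. The two outcomes correspond to reading these four vertices in
  either direction and differ in whether \<open>v2\<close> or \<open>v1\<close> is not adjacent to
  \<open>v4\<close>.\<close>

lemma skeleton_of_representation:
  assumes d: "distinct [v0, v1, v2, v3, v4]" and V: "verts G = {v0, v1, v2, v3, v4}"
    and C: "edges C = cycle_edges [v0, v1, v2, v3, v4]"
    and K: "{v0, v2} \<in> edges G" "{v0, v3} \<in> edges G" "{v1, v3} \<in> edges G"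
    and R: "represents R G C"
  shows "(skeleton (host R) (rpath R v0) (rpath R v1) (rpath R v2) (rpath R v3) (rpath R v4) \<and>
      rpath R v2 \<inter> rpath R v4 = {}) \<or>
    (skeleton (host R) (rpath R v3) (rpath R v2) (rpath R v1) (rpath R v0) (rpath R v4) \<and>
      rpath R v1 \<inter> rpath R v4 = {})"
proof -
  have rep: "is_representation (verts G) R" using R by (simp add: represents_def)
  then interpret tree_graph "host R" by unfold_locales (simp add: is_representation_def)
  define Q0 Q1 Q2 Q3 Q4 where Q: "Q0 = rpath R v0" "Q1 = rpath R v1" "Q2 = rpath R v2"
    "Q3 = rpath R v3" "Q4 = rpath R v4"
  have inV: "v0 \<in> verts G" "v1 \<in> verts G" "v2 \<in> verts G" "v3 \<in> verts G" "v4 \<in> verts G"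
    using V by auto
  have path: "is_path (host R) (rpath R v)" if "v \<in> verts G" for v
    using rep that by (simp add: is_representation_def is_path_def)
  have paths: "is_path (host R) Q0" "is_path (host R) Q1" "is_path (host R) Q2" "is_path (host R) Q3"
    "is_path (host R) Q4" unfolding Q by (intro path inV)+
  have C': "edges C = {{v0, v1}, {v1, v2}, {v2, v3}, {v3, v4}, {v4, v0}}"
    by (simp add: C cycle_edges_def)
  note rel = represents_iff[OF R]
  have d': "distinct [v4, v3, v2, v1, v0]" using d by auto
  have ns: "nonsplitting Q0 Q1" "nonsplitting Q1 Q2" "nonsplitting Q2 Q3" "nonsplitting Q3 Q4"
    "nonsplitting Q0 Q4"
    using rel(2)[OF inV(1,2)] rel(2)[OF inV(2,3)] rel(2)[OF inV(3,4)] rel(2)[OF inV(4,5)]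
      rel(2)[OF inV(1,5)] d unfolding Q C' by (simp_all add: insert_commute)
  have sp: "\<not> nonsplitting Q0 Q2" "\<not> nonsplitting Q0 Q3" "\<not> nonsplitting Q1 Q3"
    "\<not> nonsplitting Q1 Q4" "\<not> nonsplitting Q2 Q4"
    using rel(2)[OF inV(1,3)] rel(2)[OF inV(1,4)] rel(2)[OF inV(2,4)] rel(2)[OF inV(2,5)]
      rel(2)[OF inV(3,5)] d d' unfolding Q C' by (simp_all add: doubleton_eq_iff)
  have "intersecting Q0 Q2" "intersecting Q0 Q3" "intersecting Q1 Q3"
    using rel(1)[OF inV(1,3)] rel(1)[OF inV(1,4)] rel(1)[OF inV(2,4)] K d unfolding Q by simp_all
  then have int: "Q0 \<inter> Q2 \<noteq> {}" "Q0 \<inter> Q3 \<noteq> {}" "Q1 \<inter> Q3 \<noteq> {}" "Q2 \<inter> Q3 \<noteq> {}"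
    using ns(3) by (simp_all add: intersecting_def nonsplitting_def)
  obtain x y where xy: "{x, y} \<in> Q0 \<inter> Q1 \<inter> Q2 \<inter> Q3"
    using helly_four[OF paths(1-4) ns(1,2) int] .
  have sym: "ys \<parallel> xs" if "xs \<parallel> ys" for xs ys :: "'b list" using that by (auto simp: parallel_def)
  \<comment> \<open>Stated for arbitrary \<open>x\<close> and \<open>y\<close>, to be applied to
    whichever side \<open>Q0\<close> diverges from \<open>Q2\<close> on.\<close>
  have main: "(skeleton (host R) Q0 Q1 Q2 Q3 Q4 \<and> Q2 \<inter> Q4 = {}) \<or>
      (skeleton (host R) Q3 Q2 Q1 Q0 Q4 \<and> Q1 \<inter> Q4 = {})"
    if A: "arms (host R) x y Q0 L0 R0" "arms (host R) x y Q1 L1 R1" "arms (host R) x y Q2 L2 R2"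
      "arms (host R) x y Q3 L3 R3" and par: "L0 \<parallel> L2" for x y L0 R0 L1 R1 L2 R2 L3 R3
  proof -
    have L: "\<not> L0 \<parallel> L1" "\<not> L1 \<parallel> L2" "\<not> L2 \<parallel> L3"
      using arms_nonsplitting(1) A ns by metis+
    \<comment> \<open>\<open>L1\<close> ends before \<open>L0\<close> and \<open>L2\<close> diverge,
      which makes it comparable to \<open>L3\<close>; so \<open>Q1\<close> and \<open>Q3\<close>
      split on the other side.\<close>
    have "prefix L1 L2" using comparable_to_parallel[OF par] L(1,2) not_parallel_sym by metis
    then have "\<not> L1 \<parallel> L3" using L(3) by (rule prefix_not_parallel)
    then have R13: "R1 \<parallel> R3" using arms_comparable_nonsplitting A(2,4) sp(3) by metis
    have "L0 \<parallel> L3 \<or> R0 \<parallel> R3" using arms_comparable_nonsplitting A(1,4) sp(2) by metis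
    then show ?thesis
    proof
      assume "L0 \<parallel> L3"
      then show ?thesis
        using skeleton_exists[OF paths(5) A ns sp(4,5) par R13] by simp
    next
      \<comment> \<open>Exchanging \<open>Q0\<close> with \<open>Q3\<close>, \<open>Q1\<close> with
        \<open>Q2\<close>, and the two sides turns this case into the previous one.\<close>
      assume "R0 \<parallel> R3"
      moreover have "arms (host R) y x Q3 R3 L3" "arms (host R) y x Q2 R2 L2"
        "arms (host R) y x Q1 R1 L1" "arms (host R) y x Q0 R0 L0"
        using A arms_swap by metis+
      moreover have "nonsplitting Q3 Q2" "nonsplitting Q2 Q1" "nonsplitting Q1 Q0"
        using ns nonsplitting_commute by metis+
      ultimately show ?thesis
        using skeleton_exists[of Q4 y x Q3 R3 L3 Q2 R2 L2 Q1 R1 L1 Q0 R0 L0] paths(5) ns(4,5) sp(4,5)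
          sym par R13 by simp
    qed
  qed
  obtain L0 R0 where A0: "arms (host R) x y Q0 L0 R0" using arms_exist[OF paths(1)] xy by blast
  obtain L1 R1 where A1: "arms (host R) x y Q1 L1 R1" using arms_exist[OF paths(2)] xy by blast
  obtain L2 R2 where A2: "arms (host R) x y Q2 L2 R2" using arms_exist[OF paths(3)] xy by blast
  obtain L3 R3 where A3: "arms (host R) x y Q3 L3 R3" using arms_exist[OF paths(4)] xy by blast
  have "L0 \<parallel> L2 \<or> R0 \<parallel> R2" using arms_comparable_nonsplitting A0 A2 sp(1) by metis
  then show ?thesis
    using main[OF A0 A1 A2 A3] main[OF A0[unfolded arms_swap[of _ x y]] A1[unfolded arms_swap[of _ x y]]
      A2[unfolded arms_swap[of _ x y]] A3[unfolded arms_swap[of _ x y]]] unfolding Q by blast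
qed

text \<open>The collapse map sends each skeleton edge to its canonical counterpart, so the
  incidences stored in \<open>skeleton\<close> become the canonical paths. Contractions suffice, as
  they shorten the paths too.\<close>

lemma skeleton_minifies_to_canonical:
  assumes d: "distinct [v0, v1, v2, v3, v4]" and V: "V = {v0, v1, v2, v3, v4}"
    and R: "is_representation V R"
    and sk: "skeleton (host R) (rpath R v0) (rpath R v1) (rpath R v2) (rpath R v3) (rpath R v4)"
  shows "\<exists>R'. (minify V)\<^sup>*\<^sup>* R R' \<and> rep_isomorphic V R' (canonical_rep v0 v1 v2 v3 v4) \<and>
    rep_isomorphic V (canonical_rep v0 v1 v2 v3 v4) R'"
proof -
  have T: "tree (host R)" using R by (simp add: is_representation_def)
  then interpret tree_graph "host R" by unfold_locales
  from sk obtain s \<alpha> \<beta> m m' p p' t \<gamma> \<delta> F where F: "F = {{s, \<alpha>}, {s, \<beta>}, {m, m'}, {p, p'}, {t, \<gamma>}, {t, \<delta>}}"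
    and dist: "distinct [{s, \<alpha>}, {s, \<beta>}, {m, m'}, {p, p'}, {t, \<gamma>}, {t, \<delta>}]"
    and FE: "F \<subseteq> E"
    and j: "joined (E - F) s m" "joined (E - F) m' p" "joined (E - F) p' t"
    and Q: "rpath R v0 \<inter> F = {{s, \<alpha>}, {m, m'}, {p, p'}}" "rpath R v1 \<inter> F = {{m, m'}, {p, p'}, {t, \<gamma>}}"
      "rpath R v2 \<inter> F = {{s, \<beta>}, {m, m'}}" "rpath R v3 \<inter> F = {{s, \<beta>}, {m, m'}, {p, p'}, {t, \<delta>}}"
      "rpath R v4 \<inter> F = {{p, p'}, {t, \<delta>}}"
    by (rule skeletonE)
  obtain g where g: "g s = Nu" "g \<alpha> = Na" "g \<beta> = Nb" "g m = Nu" "g m' = Nm" "g p = Nm" "g p' = Nv"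
    "g t = Nv" "g \<gamma> = Nc" "g \<delta> = Nd"
    "\<And>u v. {u, v} \<in> E - F \<Longrightarrow> g u = g v"
    "\<And>u v. u \<in> verts (host R) \<Longrightarrow> v \<in> verts (host R) \<Longrightarrow> g u = g v \<Longrightarrow> joined (E - F) u v"
    using skeleton_collapse_map[OF F dist FE j] by blast
  have ed: "\<exists>x y. e = {x, y} \<and> x \<noteq> y \<and> x \<in> verts (host R) \<and> y \<in> verts (host R)" if "e \<in> E" for e
  proof -
    have "card e = 2" using T that by (simp add: tree_def simple_graph_def)
    then obtain x y where xy: "e = {x, y}" unfolding card_2_iff by blast
    then have "{x, y} \<in> E" using that by simp
    from edge_verts[OF this] show ?thesis unfolding xy by blast
  qed
  have gF: "card (g ` e) \<noteq> 1" if "e \<in> F" for e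
    using that unfolding F by (elim insertE) (simp_all add: g(1-10))
  have gE: "card (g ` e) = 1" if e: "e \<in> E - F" for e
  proof -
    obtain x y where xy: "e = {x, y}" using ed[of e] e by blast
    then have "g x = g y" using g(11)[of x y] e by simp
    then show ?thesis unfolding xy by simp
  qed
  have col: "{e \<in> E. card (g ` e) = 1} = E - F"
    by (rule set_eqI) (use gF gE in \<open>simp, metis\<close>)
  have ncol: "{e \<in> A. card (g ` e) \<noteq> 1} = A \<inter> F" if "A \<subseteq> E" for A
    by (rule set_eqI) (use that gF gE in \<open>simp, metis DiffI subsetD\<close>)
  have rpE: "\<forall>v\<in>V. rpath R v \<subseteq> E"
    using R by (auto simp: is_representation_def simple_path_def)
  have inE: "{s, \<alpha>} \<in> E" "{s, \<beta>} \<in> E" "{m, m'} \<in> E" "{t, \<gamma>} \<in> E" "{t, \<delta>} \<in> E"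
    using FE F by auto
  let ?R = "canonical_rep v0 v1 v2 v3 v4"
  show ?thesis
  proof (rule contract_fibres[where g = g])
    show "finite (verts (host R))" using T by (simp add: tree_def simple_graph_def)
    show "\<forall>e\<in>E. \<exists>x y. e = {x, y} \<and> x \<noteq> y \<and> x \<in> verts (host R) \<and> y \<in> verts (host R)"
      using ed by blast
    show "\<forall>v\<in>V. rpath R v \<subseteq> E" by (rule rpE)
    show "\<forall>x\<in>verts (host R). \<forall>y\<in>verts (host R). g x = g y \<longrightarrow> joined {e \<in> E. card (g ` e) = 1} x y"
      unfolding col using g(12) by simp
    show "g ` verts (host R) = verts (host ?R)"
    proof -
      have "n \<in> g ` {s, \<alpha>, \<beta>, m', t, \<gamma>, \<delta>}" for n by (cases n) (simp_all add: g(1-10))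
      moreover have "{s, \<alpha>, \<beta>, m', t, \<gamma>, \<delta>} \<subseteq> verts (host R)" using inE edge_verts by blast
      moreover have "n \<in> verts canonical_tree" for n by (cases n) (simp_all add: canonical_tree_def)
      ultimately show ?thesis by auto
    qed
    show "(`) g ` {e \<in> E. card (g ` e) \<noteq> 1} = edges (host ?R)"
    proof -
      have "{e \<in> E. card (g ` e) \<noteq> 1} = F" using ncol[of E] FE by blast
      then show ?thesis unfolding F by (simp add: g(1-10) canonical_tree_def insert_commute)
    qed
    show "\<forall>v\<in>V. (`) g ` {e \<in> rpath R v. card (g ` e) \<noteq> 1} = rpath ?R v"
    proof
      fix v assume v: "v \<in> V"
      have "{e \<in> rpath R v. card (g ` e) \<noteq> 1} = rpath R v \<inter> F" using ncol rpE v by blast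
      moreover have "(`) g ` (rpath R v \<inter> F) = rpath ?R v"
        using v unfolding V by (elim insertE) (simp_all add: Q canonical_rpath[OF d] g(1-10) insert_commute)
      ultimately show "(`) g ` {e \<in> rpath R v. card (g ` e) \<noteq> 1} = rpath ?R v" by simp
    qed
  qed
qed

section \<open>Labelling of the cycle and the final theorem\<close>

lemma cycle_labelling:
  assumes "hamiltonian_cycle C G" "card (verts G) = 5" "S \<subseteq> verts G" "card S = 4"
  obtains v0 v1 v2 v3 v4 where "distinct [v0, v1, v2, v3, v4]" "verts G = {v0, v1, v2, v3, v4}"
    "edges C = cycle_edges [v0, v1, v2, v3, v4]" "S = {v0, v1, v2, v3}"
proof -
  obtain xs where xs: "distinct xs" "verts G = set xs" "edges C = cycle_edges xs"
    using assms(1) by (auto simp: hamiltonian_cycle_def cycle_graph_def)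
  then have "length xs = 5" using assms(2) distinct_card by metis
  then obtain a b c d e where eq: "xs = [a, b, c, d, e]"
    by (auto simp: length_Suc_conv eval_nat_numeral)
  have fin: "finite (verts G)" using xs by simp
  have "card (verts G - S) = 1" using assms(2-4) fin by (simp add: card_Diff_subset finite_subset)
  then obtain z where z: "verts G - S = {z}" using card_1_singletonE by blast
  then have S: "S = verts G - {z}" using assms(3) by blast
  have V: "verts G = {a, b, c, d, e}" using xs(2) eq by simp
  have C: "edges C = {{a, b}, {b, c}, {c, d}, {d, e}, {e, a}}"
    using xs(3) by (simp add: eq cycle_edges_def)
  have rot: "cycle_edges [v0, v1, v2, v3, v4] = {{v0, v1}, {v1, v2}, {v2, v3}, {v3, v4}, {v4, v0}}"
    for v0 v1 v2 v3 v4 :: 'a by (simp add: cycle_edges_def)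
  have dist: "distinct [a, b, c, d, e]" using xs(1) eq by simp
  \<comment> \<open>The cycle is rotated until the vertex outside \<open>S\<close> comes last and
    becomes \<open>v4\<close>.\<close>
  have "z \<in> {a, b, c, d, e}" using z V by blast
  then consider "z = a" | "z = b" | "z = c" | "z = d" | "z = e" by blast
  then show ?thesis
  proof cases
    case 1
    show ?thesis by (rule that[of b c d e a]) (use 1 dist in \<open>auto simp: rot C V S\<close>)
  next
    case 2
    show ?thesis by (rule that[of c d e a b]) (use 2 dist in \<open>auto simp: rot C V S\<close>)
  next
    case 3
    show ?thesis by (rule that[of d e a b c]) (use 3 dist in \<open>auto simp: rot C V S\<close>)
  next
    case 4
    show ?thesis by (rule that[of e a b c d]) (use 4 dist in \<open>auto simp: rot C V S\<close>)
  next
    case 5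
    show ?thesis by (rule that[of a b c d e]) (use 5 dist in \<open>auto simp: rot C V S\<close>)
  qed
qed

text \<open>Of the ten pairs, the cycle edges and three chords are given. \<open>{v1, v4}\<close> is
  an edge because both paths contain the skeleton edge \<open>f\<close>, and disjointness excludes
  \<open>{v2, v4}\<close>.\<close>

lemma edges_of_skeleton:
  assumes pair: "graph_pair G C" and d: "distinct [v0, v1, v2, v3, v4]"
    and V: "verts G = {v0, v1, v2, v3, v4}" and C: "edges C = cycle_edges [v0, v1, v2, v3, v4]"
    and K: "{v0, v2} \<in> edges G" "{v0, v3} \<in> edges G" "{v1, v3} \<in> edges G"
    and R: "represents R G C"
    and sk: "skeleton (host R) (rpath R v0) (rpath R v1) (rpath R v2) (rpath R v3) (rpath R v4)"
      "rpath R v2 \<inter> rpath R v4 = {}"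
  shows "edges G = edges C \<union> {{v0, v2}, {v0, v3}, {v1, v3}, {v1, v4}}"
proof -
  from sk(1) have int: "rpath R v1 \<inter> rpath R v4 \<noteq> {}"
  proof (rule skeletonE)
    fix s \<alpha> \<beta> m m' p p' t \<gamma> \<delta> F
    assume "rpath R v1 \<inter> F = {{m, m'}, {p, p'}, {t, \<gamma>}}" "rpath R v4 \<inter> F = {{p, p'}, {t, \<delta>}}"
    then have "{p, p'} \<in> rpath R v1 \<inter> F" "{p, p'} \<in> rpath R v4 \<inter> F" by simp_all
    then show ?thesis by blast
  qed
  have inV: "v1 \<in> verts G" "v2 \<in> verts G" "v4 \<in> verts G" using V by auto
  have 14: "{v1, v4} \<in> edges G"
    using represents_iff(1)[OF R inV(1,3)] d int by (simp add: intersecting_def)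
  have 24: "{v2, v4} \<notin> edges G"
    using represents_iff(1)[OF R inV(2,3)] d sk(2) by (simp add: intersecting_def)
  have C': "edges C = {{v0, v1}, {v1, v2}, {v2, v3}, {v3, v4}, {v4, v0}}"
    by (simp add: C cycle_edges_def)
  have CG: "edges C \<subseteq> edges G" using pair by (simp add: graph_pair_def)
  have "e \<in> edges C \<union> {{v0, v2}, {v0, v3}, {v1, v3}, {v1, v4}}" if e: "e \<in> edges G" for e
  proof -
    have "e \<subseteq> verts G" "card e = 2" using pair e by (auto simp: graph_pair_def simple_graph_def)
    then obtain x y where xy: "e = {x, y}" "x \<noteq> y" "x \<in> {v0, v1, v2, v3, v4}" "y \<in> {v0, v1, v2, v3, v4}"
      unfolding V card_2_iff by blast
    have "e \<noteq> {v2, v4}" using e 24 by blast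
    then show ?thesis using xy(2,3,4) unfolding xy(1) C'
      by (elim insertE emptyE) (simp_all add: insert_commute)
  qed
  then show ?thesis using CG K 14 by blast
qed

text \<open>The labelling is found from one representation over \<open>'r\<close> but speaks of
  \<open>G\<close> and \<open>C\<close> only, so the reduction can be rerun for a minimal
  representation over any other host type \<open>'t\<close>.\<close>

theorem theorem6:
  fixes G C :: "'v graph"
  assumes "graph_pair G C"
    and "card (verts G) = 5"
    and "hamiltonian_cycle C G"
    and "\<exists>R :: ('v, 'r) representation. represents R G C"
    and "\<not> P2 G C"
  shows "\<exists>v0 v1 v2 v3 v4.
           distinct [v0, v1, v2, v3, v4] \<and>
           verts G = {v0, v1, v2, v3, v4} \<and>
           edges C = cycle_edges [v0, v1, v2, v3, v4] \<and>
           edges G = edges C \<union> {{v0, v2}, {v0, v3}, {v1, v3}, {v1, v4}} \<and>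
           minimal_representation (canonical_rep v0 v1 v2 v3 v4) G C \<and>
           (\<forall>R :: ('v, 't) representation. minimal_representation R G C \<longrightarrow>
              rep_isomorphic (verts G) R (canonical_rep v0 v1 v2 v3 v4))"
proof -
  obtain R :: "('v, 'r) representation" where R: "represents R G C" using assms(4) by blast
  obtain S where S: "S \<subseteq> verts G" "card S = 4" "complete_graph (induced_subgraph G S)"
    using assms(5) by (auto simp: P2_def)
  obtain w0 w1 w2 w3 w4 where w: "distinct [w0, w1, w2, w3, w4]" "verts G = {w0, w1, w2, w3, w4}"
    "edges C = cycle_edges [w0, w1, w2, w3, w4]" "S = {w0, w1, w2, w3}"
    using cycle_labelling[OF assms(3,2) S(1,2)] .
  have "{x, y} \<in> edges G" if "x \<in> S" "y \<in> S" "x \<noteq> y" for x y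
  proof -
    have "{x, y} \<in> edges (induced_subgraph G S)"
      using S(3) that unfolding complete_graph_def by (auto simp: induced_subgraph_def)
    then show ?thesis by (simp add: induced_subgraph_def)
  qed
  then have K: "{w0, w2} \<in> edges G" "{w0, w3} \<in> edges G" "{w1, w3} \<in> edges G"
    using w(1,4) by auto
  have "\<exists>v0 v1 v2 v3 v4. distinct [v0, v1, v2, v3, v4] \<and> verts G = {v0, v1, v2, v3, v4} \<and>
    edges C = cycle_edges [v0, v1, v2, v3, v4] \<and>
    edges G = edges C \<union> {{v0, v2}, {v0, v3}, {v1, v3}, {v1, v4}}"
    using skeleton_of_representation[OF w(1-3) K R]
  proof (elim disjE conjE)
    assume "skeleton (host R) (rpath R w0) (rpath R w1) (rpath R w2) (rpath R w3) (rpath R w4)"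
      "rpath R w2 \<inter> rpath R w4 = {}"
    from edges_of_skeleton[OF assms(1) w(1-3) K R this] show ?thesis using w(1-3) by blast
  next
    assume sk: "skeleton (host R) (rpath R w3) (rpath R w2) (rpath R w1) (rpath R w0) (rpath R w4)"
      "rpath R w1 \<inter> rpath R w4 = {}"
    \<comment> \<open>Reversing the first four labels keeps the cycle and exchanges
      \<open>w1\<close> with \<open>w2\<close>.\<close>
    have w': "distinct [w3, w2, w1, w0, w4]" "verts G = {w3, w2, w1, w0, w4}"
      "edges C = cycle_edges [w3, w2, w1, w0, w4]"
      "{w3, w1} \<in> edges G" "{w3, w0} \<in> edges G" "{w2, w0} \<in> edges G"
      using w(1-3) K by (auto simp: cycle_edges_def insert_commute)
    from edges_of_skeleton[OF assms(1) w'(1-6) R sk] show ?thesis using w'(1-3) by blast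
  qed
  then obtain v0 v1 v2 v3 v4 where v: "distinct [v0, v1, v2, v3, v4]" "verts G = {v0, v1, v2, v3, v4}"
    "edges C = cycle_edges [v0, v1, v2, v3, v4]"
    "edges G = edges C \<union> {{v0, v2}, {v0, v3}, {v1, v3}, {v1, v4}}" by blast
  let ?K = "canonical_rep v0 v1 v2 v3 v4"
  have rep: "represents ?K G C" using canonical_represents[OF v] .
  have "minimal_representation ?K G C"
    unfolding minimal_representation_def using rep minify_canonical[OF v] by blast
  moreover have "rep_isomorphic (verts G) M ?K" if M: "minimal_representation M G C"
    for M :: "('v, 't) representation"
  proof -
    have repM: "represents M G C" using M by (simp add: minimal_representation_def)
    then have isM: "is_representation (verts G) M" by (simp add: represents_def)
    have Kv: "{v0, v2} \<in> edges G" "{v0, v3} \<in> edges G" "{v1, v3} \<in> edges G" "{v1, v4} \<in> edges G"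
      using v(4) by auto
    \<comment> \<open>\<open>v1\<close> and \<open>v4\<close> are adjacent, which excludes the
      reversed alternative, so the labels fixed above fit \<open>M\<close>.\<close>
    then have "rpath M v1 \<inter> rpath M v4 \<noteq> {}"
      using represents_iff(1)[OF repM, of v1 v4] v(1,2) by (simp add: intersecting_def)
    then have "skeleton (host M) (rpath M v0) (rpath M v1) (rpath M v2) (rpath M v3) (rpath M v4)"
      using skeleton_of_representation[OF v(1-3) Kv(1-3) repM] by blast
    from skeleton_minifies_to_canonical[OF v(1,2) isM this] obtain M' where
      M': "(minify (verts G))\<^sup>*\<^sup>* M M'" "rep_isomorphic (verts G) M' ?K" "rep_isomorphic (verts G) ?K M'"
      by blast
    have "represents M' G C" using represents_transport[OF rep M'(3)] .
    then have "rep_isomorphic (verts G) M M'"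
      using M M'(1) unfolding minimal_representation_def by blast
    then show ?thesis using M'(2) by (rule rep_isomorphic_trans)
  qed
  ultimately show ?thesis using v by blast
qed

end
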